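(* Let $W=w_1\oplus\cdots\oplus w_N$ and $\widetilde W=\widetilde w_1\oplus\cdots\oplus\widetilde w_N$ be direct sums of classical scalar weights, all $w_j$ and $\widetilde w_j$ being of the same type (all shifted Hermite, all Laguerre, or all Jacobi). Then $\widetilde W$ is a Darboux transformation of $W$ if and only if there exists a permutation $\sigma$ of $\{1,\dots,N\}$ such that $\widetilde w_j$ is a Darboux transformation of $w_{\sigma(j)}$ for all $j=1,\dots,N$.
   Context: Classical scalar weights: shifted Hermite $w_b(x)=e^{-x^2+2bx}$ on $(-\infty,\infty)$, $b\in\mathbb R$; Laguerre $w_\alpha(x)=e^{-x}x^\alpha$ on $(0,\infty)$, $\alpha>-1$; Jacobi $w_{\alpha,\beta}(x)=(1-x)^\alpha(1+x)^\beta$ on $(-1,1)$, $\alpha,\beta>-1$. $w_1\oplus\cdots\oplus w_N$ is the diagonal weight matrix $\operatorname{diag}(w_1,\dots,w_N)$. Differential operators $D=\sum_{j}\partial^jF_j(x)$, $\partial=\frac{d}{dx}$, act on the right on matrix-valued functions: $P(x)\cdot D=\sum_j \partial^j(P)(x)F_j(x)$; the product satisfies $P\cdot(D_1D_2)=(P\cdot D_1)\cdot D_2$. $\operatorname{Mat}_N(\Omega[x])$ is the algebra of such operators with all $F_j\in\operatorname{Mat}_N(\mathbb C)[x]$. For a weight matrix $W$ of size $N$ on an interval, the monic orthogonal polynomials $P_n$ are those with leading coefficient $I$, degree $n$, and $\int P_nWP_m^*\,dx=0$ for $n\neq m$; $\mathcal D(W)$ is the algebra of all $D\in\operatorname{Mat}_N(\Omega[x])$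 such that for every $n\ge0$ there is $\Lambda_n(D)\in\operatorname{Mat}_N(\mathbb C)$ with $P_n\cdot D=\Lambda_n(D)P_n$. An operator $\mathcal V\in\operatorname{Mat}_N(\Omega[x])$ is degree-preserving if $\deg(P\cdot\mathcal V)=\deg P$ for all $P\in\operatorname{Mat}_N(\mathbb C)[x]$. Darboux transformation: for weight matrices $W,\widetilde W$ of size $N$ (scalar weights being the case $N=1$) on the same interval with monic orthogonal polynomials $P_n,\widetilde P_n$, $\widetilde W$ is a Darboux transformation of $W$ if there is $D\in\mathcal D(W)$ that factors as $D=\mathcal V\mathcal N$ with $\mathcal V,\mathcal N\in\operatorname{Mat}_N(\Omega[x])$ degree-preserving and such that $P_n\cdot\mathcal V=A_n\widetilde P_n$ for all $n\in\mathbb N_0$, for some matrices $A_n\in\operatorname{Mat}_N(\mathbb C)$. *)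

theory Defs
  imports
    "HOL-Analysis.Analysis"
    "HOL-Computational_Algebra.Polynomial"
    "HOL-Combinatorics.Permutations"
begin

section \<open>Matrix polynomials\<close>

text \<open>
  \<open>Mat\<^sub>N(\<complex>)[x]\<close> is modelled as matrices of complex polynomials, with the size \<open>N\<close> given by the
  finite index type \<open>'n\<close>.  Products are always taken with \<open>**\<close>, since \<open>*\<close> on these types is the
  componentwise product.
\<close>

type_synonym 'n cmat = "((complex, 'n) vec, 'n) vec"
type_synonym 'n pmat = "((complex poly, 'n) vec, 'n) vec"

definition const_pmat :: "'n::finite cmat \<Rightarrow> 'n pmat" where
  "const_pmat A = map_matrix (\<lambda>c. [:c:]) A"

definition pmat_deriv :: "'n::finite pmat \<Rightarrow> 'n pmat" where
  "pmat_deriv P = map_matrix pderiv P"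

definition pmat_eval :: "'n::finite pmat \<Rightarrow> real \<Rightarrow> 'n cmat" where
  "pmat_eval P x = map_matrix (\<lambda>p. poly p (complex_of_real x)) P"

definition pmat_coeff :: "'n::finite pmat \<Rightarrow> nat \<Rightarrow> 'n cmat" where
  "pmat_coeff P k = map_matrix (\<lambda>p. coeff p k) P"

text \<open>As for \<^const>\<open>degree\<close>, the zero matrix polynomial gets degree \<open>0\<close>.\<close>

definition pmat_degree :: "'n::finite pmat \<Rightarrow> nat" where
  "pmat_degree P = Max {degree (P $ i $ j) | i j. True}"

definition conj_transpose :: "'n::finite cmat \<Rightarrow> 'n cmat" where
  "conj_transpose A = transpose (map_matrix cnj A)"


section \<open>Differential operators\<close>

text \<open>
  The operator \<open>\<Sum>\<^sub>j \<partial>\<^sup>j F\<^sub>j(x)\<close> is identified with the map \<open>P \<mapsto> P \<cdot> D\<close> on matrix polynomials, so the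
  application \<open>D P\<close> stands for \<open>P \<cdot> D\<close>.  This map determines the coefficients \<open>F\<^sub>j\<close>, see the lemma
  \<open>diff_op_coeffs_unique\<close> below.
\<close>

type_synonym 'n pmat_op = "'n pmat \<Rightarrow> 'n pmat"

definition diff_op :: "nat \<Rightarrow> (nat \<Rightarrow> 'n::finite pmat) \<Rightarrow> 'n pmat_op" where
  "diff_op r F = (\<lambda>P. \<Sum>j\<le>r. (pmat_deriv ^^ j) P ** F j)"

definition diff_ops :: "'n::finite pmat_op set" where
  "diff_ops = {D. \<exists>r F. D = diff_op r F}"

text \<open>Operators act on the right, \<open>P \<cdot> (D\<^sub>1 D\<^sub>2) = (P \<cdot> D\<^sub>1) \<cdot> D\<^sub>2\<close>: the left factor is applied first.\<close>

definition op_mult :: "'n::finite pmat_op \<Rightarrow> 'n pmat_op \<Rightarrow> 'n pmat_op" where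
  "op_mult D\<^sub>1 D\<^sub>2 = (\<lambda>P. D\<^sub>2 (D\<^sub>1 P))"

text \<open>
  The zero matrix polynomial has degree \<open>-\<infinity>\<close> in the mathematical definition, so a degree-preserving
  operator does not annihilate a nonzero constant.  As \<^const>\<open>pmat_degree\<close> does not distinguish
  the two, this is a separate condition.
\<close>

definition degree_preserving :: "'n::finite pmat_op \<Rightarrow> bool" where
  "degree_preserving V \<longleftrightarrow>
     (\<forall>P. (V P = 0 \<longleftrightarrow> P = 0) \<and> pmat_degree (V P) = pmat_degree P)"


section \<open>Orthogonal polynomials and Darboux transformations\<close>

definition monic_orthogonal ::
    "real set \<Rightarrow> (real \<Rightarrow> 'n::finite cmat) \<Rightarrow> (nat \<Rightarrow> 'n pmat) \<Rightarrow> bool" where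
  "monic_orthogonal S W P \<longleftrightarrow>
     (\<forall>n. pmat_degree (P n) = n \<and> pmat_coeff (P n) n = mat 1) \<and>
     (\<forall>n m. n \<noteq> m \<longrightarrow>
        (LINT x:S|lborel. pmat_eval (P n) x ** W x ** conj_transpose (pmat_eval (P m) x)) = 0)"

text \<open>The sequence is uniquely determined whenever \<open>W\<close> is a weight matrix on the interval \<open>S\<close>.\<close>

definition monic_ops :: "real set \<Rightarrow> (real \<Rightarrow> 'n::finite cmat) \<Rightarrow> nat \<Rightarrow> 'n pmat" where
  "monic_ops S W = (THE P. monic_orthogonal S W P)"

definition op_algebra :: "real set \<Rightarrow> (real \<Rightarrow> 'n::finite cmat) \<Rightarrow> 'n pmat_op set" where
  "op_algebra S W =
     {D \<in> diff_ops. \<forall>n. \<exists>\<Lambda>. D (monic_ops S W n) = const_pmat \<Lambda> ** monic_ops S W n}"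

text \<open>\<open>darboux_transformation S W W'\<close>: \<open>W'\<close> is a Darboux transformation of \<open>W\<close>, both weight matrices
  on the interval \<open>S\<close>.\<close>

definition darboux_transformation ::
    "real set \<Rightarrow> (real \<Rightarrow> 'n::finite cmat) \<Rightarrow> (real \<Rightarrow> 'n cmat) \<Rightarrow> bool" where
  "darboux_transformation S W W' \<longleftrightarrow>
     (\<exists>D \<in> op_algebra S W. \<exists>V \<in> diff_ops. \<exists>N \<in> diff_ops.
        D = op_mult V N \<and> degree_preserving V \<and> degree_preserving N \<and>
        (\<forall>n. \<exists>A. V (monic_ops S W n) = const_pmat A ** monic_ops S W' n))"


section \<open>Classical weights\<close>

datatype weight_type = Hermite | Laguerre | Jacobi

fun weight_interval :: "weight_type \<Rightarrow> real set" where
  "weight_interval Hermite = UNIV"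
| "weight_interval Laguerre = {0<..}"
| "weight_interval Jacobi = {-1<..<1}"

text \<open>Only the values on \<^const>\<open>weight_interval\<close> are relevant.\<close>

fun classical_weights :: "weight_type \<Rightarrow> (real \<Rightarrow> real) set" where
  "classical_weights Hermite = {\<lambda>x. exp (- x\<^sup>2 + 2 * b * x) | b. True}"
| "classical_weights Laguerre = {\<lambda>x. exp (- x) * x powr \<alpha> | \<alpha>. \<alpha> > -1}"
| "classical_weights Jacobi =
     {\<lambda>x. (1 - x) powr \<alpha> * (1 + x) powr \<beta> | \<alpha> \<beta>. \<alpha> > -1 \<and> \<beta> > -1}"

definition direct_sum_weight :: "('n::finite \<Rightarrow> real \<Rightarrow> real) \<Rightarrow> real \<Rightarrow> 'n cmat" where
  "direct_sum_weight w x = (\<chi> i j. if i = j then complex_of_real (w i x) else 0)"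

definition scalar_weight :: "(real \<Rightarrow> real) \<Rightarrow> real \<Rightarrow> 1 cmat" where
  "scalar_weight w = direct_sum_weight (\<lambda>_. w)"


section \<open>Uniqueness of the coefficients of a differential operator\<close>

lemma pmat_deriv_pow_mat:
  "(pmat_deriv ^^ j) (mat p :: 'n::finite pmat) = mat ((pderiv ^^ j) p)"
proof (induction j)
  case (Suc j)
  have "pmat_deriv (mat q :: 'n pmat) = mat (pderiv q)" for q
    by (auto simp: pmat_deriv_def mat_def vec_eq_iff)
  with Suc show ?case by simp
qed simp

lemma mat_mult_left: "(mat p :: 'n::finite pmat) ** A = map_matrix ((*) p) A"
  by (simp add: matrix_matrix_mult_def mat_def vec_eq_iff if_distrib[of "\<lambda>x. x * _"]
      cong: if_cong)

lemma higher_pderiv_monom_1: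
  "(pderiv ^^ j) (monom (1::complex) m) =
     (if j \<le> m then monom (fact m / fact (m - j)) (m - j) else 0)"
proof (induction j)
  case (Suc j)
  show ?case
  proof (cases "Suc j \<le> m")
    case True
    then have "m - j = Suc (m - Suc j)" by simp
    then show ?thesis using Suc True by (simp add: pderiv_monom field_simps)
  next
    case False
    then show ?thesis using Suc by (auto simp: pderiv_monom)
  qed
qed simp

lemma diff_op_coeffs_unique:
  fixes F G :: "nat \<Rightarrow> 'n::finite pmat"
  assumes "diff_op r F = diff_op r G" and "m \<le> r"
  shows "F m = G m"
  using assms(2)
proof (induction m rule: less_induct)
  case (less m)
  define T where "T H j = (pmat_deriv ^^ j) (mat (monom 1 m) :: 'n pmat) ** H j"
    for H :: "nat \<Rightarrow> 'n pmat" and j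
  have T: "T H j = (if j \<le> m then map_matrix ((*) (monom (fact m / fact (m - j)) (m - j))) (H j) else 0)"
    for H j
    by (auto simp: T_def pmat_deriv_pow_mat higher_pderiv_monom_1 mat_mult_left vec_eq_iff)
  have "(\<Sum>j\<le>r. T F j) = (\<Sum>j\<le>r. T G j)"
    using fun_cong[OF assms(1), of "mat (monom 1 m)"] by (simp add: diff_op_def T_def)
  moreover have "(\<Sum>j\<in>{..r} - {m}. T F j) = (\<Sum>j\<in>{..r} - {m}. T G j)"
    using less by (intro sum.cong) (auto simp: T)
  ultimately have "T F m = T G m"
    using less.prems by (simp add: sum.remove[of "{..r}" m])
  then show ?case
    by (simp add: T vec_eq_iff)
qed

end

theory Submission
  imports Defs "HOL-Probability.Distributions" "HOL-Real_Asymp.Real_Asymp"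
begin

text \<open>
  Write \<open>L\<^sub>w p = \<integral> p w\<close> for the moment functional of a scalar weight \<open>w\<close> and \<open>p\<^sub>n\<close> for its monic
  orthogonal polynomials.  The monic orthogonal polynomials of a direct sum are the diagonal
  matrices of the scalar ones, so a matrix operator \<open>\<V>\<close> with \<open>P\<^sub>n \<cdot> \<V> = A\<^sub>n P'\<^sub>n\<close> is a matrix of
  scalar operators \<open>\<V>\<^sub>i\<^sub>j\<close>, each of which \<^emph>\<open>intertwines\<close>: it sends the \<open>n\<close>-th orthogonal polynomial
  of \<open>w\<^sub>i\<close> to a multiple, with the factor \<open>(A\<^sub>n)\<^sub>i\<^sub>j\<close>, of that of \<open>w'\<^sub>j\<close>.

  Let \<open>W'\<close> be a Darboux transformation of \<open>W\<close>.  Since \<open>\<V>\<close> kills no nonzero constant, \<open>A\<^sub>0\<close> is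
  invertible, and a nonzero term in the expansion of its determinant is a permutation \<open>\<sigma>\<close> for
  which all the \<open>\<V>\<^sub>\<sigma>\<^sub>(\<^sub>j\<^sub>)\<^sub>,\<^sub>j\<close> are nonzero (\<open>darboux_imp_intertwiners\<close>).  Such an entry need not be
  degree-preserving, because \<open>(A\<^sub>n)\<^sub>i\<^sub>j\<close> may vanish for some \<open>n\<close>.  What is needed is that between two
  classical weights the existence of one nonzero intertwiner already yields degree-preserving
  intertwiners in both directions (\<open>classical_intertwiner_imp_intertwined\<close>).  This is proved
  through the parameters of the weights.

  For the necessary conditions, a classical weight has a second-order operator
  \<open>\<delta> = \<phi> d\<^sup>2 + \<psi> d\<close> with \<open>\<delta> p\<^sub>n = \<lambda>\<^sub>n p\<^sub>n\<close>, where \<open>\<phi>\<close> depends on the type only.  If two weights have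
  the same eigenvalues, then an intertwiner \<open>V\<close> satisfies \<open>V \<circ> \<delta> = \<delta>' \<circ> V\<close>, and comparing the
  coefficients just below the leading order gives the differential equation
  \<open>g (r \<phi>' + \<psi> - \<psi>') = 2 \<phi> g'\<close> for the leading coefficient \<open>g\<close> of \<open>V\<close>, \<open>r\<close> being its order
  (\<open>principal_coefficient_equation\<close>).  A nonzero polynomial solution forces \<open>b = b'\<close> for Hermite
  weights and \<open>\<alpha>' - \<alpha> \<in> \<int>\<close> for Laguerre and Jacobi weights.  For Jacobi weights the eigenvalues
  \<open>\<lambda>\<^sub>n = - n (n + \<alpha> + \<beta> + 1)\<close> depend on \<open>\<alpha> + \<beta>\<close>, and \<open>\<alpha> + \<beta> = \<alpha>' + \<beta>'\<close> has to be shown first: by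
  comparing Taylor coefficients at the singular point \<open>1\<close>, \<open>\<lambda>'\<^sub>n\<close> is a rational function of \<open>\<lambda>\<^sub>n\<close>,
  so it shares the symmetry \<open>n \<mapsto> - n - \<alpha> - \<beta> - 1\<close> of \<open>\<lambda>\<^sub>n\<close> (\<open>jacobi_intertwiner_same_sum\<close>).

  Conversely, these conditions suffice: explicit first-order operators and their adjoints connect
  \<open>\<alpha>\<close> with \<open>\<alpha> + 1\<close> for Laguerre weights and \<open>(\<alpha>, \<beta> + 1)\<close> with \<open>(\<alpha> + 1, \<beta>)\<close> for Jacobi weights,
  and compositions of them cover all integer shifts.  Finally, degree-preserving intertwiners
  \<open>w\<^sub>\<sigma>\<^sub>(\<^sub>j\<^sub>) \<rightarrow> w'\<^sub>j\<close> and back assemble to permuted diagonal matrices \<open>\<V>\<close>, \<open>\<N>\<close> whose product lies in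
  \<open>\<D>(W)\<close> (\<open>intertwined_imp_darboux\<close>).  Darboux transformations of scalar weights
  are covered by the same two matrix lemmas, in size one.
\<close>

section \<open>Degree reduction for polynomials\<close>

lemma coeff_eq_imp_lower_degree:
  fixes p q :: "'a::comm_ring_1 poly"
  assumes "degree p \<le> n" "degree q \<le> n" "coeff p n = coeff q n"
  shows "p = q \<or> degree (p - q) < n"
proof (cases "p = q")
  case False
  have "degree (p - q) \<le> n" using assms by (simp add: degree_diff_le)
  moreover have "degree (p - q) \<noteq> n"
    using False assms(3) by (metis coeff_diff diff_self leading_coeff_0_iff right_minus_eq)
  ultimately show ?thesis by simp
qed simp

text \<open>A monic sequence with one member in each degree is a basis of the polynomials.\<close>

lemma monic_sequence_induct:
  fixes B :: "nat \<Rightarrow> 'a::comm_ring_1 poly"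
  assumes B: "\<And>n. degree (B n) = n" "\<And>n. coeff (B n) n = 1"
    and zero: "Q 0" and basis: "\<And>n. Q (B n)"
    and add: "\<And>p q. Q p \<Longrightarrow> Q q \<Longrightarrow> Q (p + q)" and smult: "\<And>c p. Q p \<Longrightarrow> Q (smult c p)"
  shows "Q p"
proof (induction "degree p" arbitrary: p rule: less_induct)
  case less
  define n where "n = degree p"
  define r where "r = smult (coeff p n) (B n)"
  have "degree r \<le> n" by (simp add: r_def B degree_smult_le[THEN order_trans])
  then have "p = r \<or> degree (p - r) < n"
    by (intro coeff_eq_imp_lower_degree) (auto simp: n_def r_def B)
  then have "Q (p - r)" using less[of "p - r"] zero by (auto simp: n_def)
  moreover have "Q r" by (simp add: r_def basis smult)
  ultimately show ?case using add[of "p - r" r] by simp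
qed

section \<open>Scalar differential operators with polynomial coefficients\<close>

definition scalar_diff_ops :: "(complex poly \<Rightarrow> complex poly) set" where
  "scalar_diff_ops = {L. \<exists>r f. L = (\<lambda>p. \<Sum>j\<le>r. (pderiv ^^ j) p * f j)}"

text \<open>
  The order bound may be enlarged at will, so that finitely many operators can be given a common
  bound.
\<close>

lemma scalar_diff_ops_padE:
  assumes "L \<in> scalar_diff_ops"
  obtains r f where "\<And>R p. r \<le> R \<Longrightarrow> L p = (\<Sum>j\<le>R. (pderiv ^^ j) p * f j)"
    and "\<And>j. r < j \<Longrightarrow> f j = 0"
proof -
  obtain r f where L: "L = (\<lambda>p. \<Sum>j\<le>r. (pderiv ^^ j) p * f j)"
    using assms by (auto simp: scalar_diff_ops_def)
  show thesis
  proof (rule that[of r "\<lambda>j. if j \<le> r then f j else 0"])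
    fix R p assume "r \<le> R"
    then show "L p = (\<Sum>j\<le>R. (pderiv ^^ j) p * (if j \<le> r then f j else 0))"
      unfolding L by (intro sum.mono_neutral_cong_left) auto
  qed simp
qed

lemma scalar_diff_ops_zero: "(\<lambda>p. 0) \<in> scalar_diff_ops"
  by (auto simp: scalar_diff_ops_def intro!: exI[of _ 0] exI[of _ "\<lambda>_. 0"])

lemma scalar_diff_ops_term: "(\<lambda>p. (pderiv ^^ j) p * g) \<in> scalar_diff_ops"
  by (auto simp: scalar_diff_ops_def fun_eq_iff if_distrib[of "(*) _"] cong: if_cong
      intro!: exI[of _ j] exI[of _ "\<lambda>i. if i = j then g else 0"])

lemma scalar_diff_ops_add:
  assumes "L \<in> scalar_diff_ops" "M \<in> scalar_diff_ops"
  shows "(\<lambda>p. L p + M p) \<in> scalar_diff_ops"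
proof -
  obtain r f where L: "\<And>R p. r \<le> R \<Longrightarrow> L p = (\<Sum>j\<le>R. (pderiv ^^ j) p * f j)"
    using scalar_diff_ops_padE[OF assms(1)] by metis
  obtain s g where M: "\<And>R p. s \<le> R \<Longrightarrow> M p = (\<Sum>j\<le>R. (pderiv ^^ j) p * g j)"
    using scalar_diff_ops_padE[OF assms(2)] by metis
  have "L p + M p = (\<Sum>j\<le>max r s. (pderiv ^^ j) p * (f j + g j))" for p
    by (simp add: L[of "max r s"] M[of "max r s"] distrib_left sum.distrib)
  then show ?thesis by (auto simp: scalar_diff_ops_def)
qed

lemma scalar_diff_ops_sum:
  "(\<And>i. i \<in> I \<Longrightarrow> L i \<in> scalar_diff_ops) \<Longrightarrow> (\<lambda>p. \<Sum>i\<in>I. L i p) \<in> scalar_diff_ops"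
  by (induction I rule: infinite_finite_induct) (auto simp: scalar_diff_ops_zero scalar_diff_ops_add)

lemma scalar_diff_ops_mult:
  assumes "L \<in> scalar_diff_ops"
  shows "(\<lambda>p. L p * g) \<in> scalar_diff_ops"
proof -
  obtain r f where "L = (\<lambda>p. \<Sum>j\<le>r. (pderiv ^^ j) p * f j)"
    using assms by (auto simp: scalar_diff_ops_def)
  then have "(\<lambda>p. L p * g) = (\<lambda>p. \<Sum>j\<le>r. (pderiv ^^ j) p * (f j * g))"
    by (simp add: sum_distrib_right mult.assoc)
  then show ?thesis unfolding scalar_diff_ops_def by auto
qed

lemma scalar_diff_ops_pderiv:
  assumes "L \<in> scalar_diff_ops"
  shows "(\<lambda>p. pderiv (L p)) \<in> scalar_diff_ops"
proof -
  obtain r f where L: "L = (\<lambda>p. \<Sum>j\<le>r. (pderiv ^^ j) p * f j)"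
    using assms by (auto simp: scalar_diff_ops_def)
  have "pderiv (L p) = (\<Sum>j\<le>r. (pderiv ^^ Suc j) p * f j + (pderiv ^^ j) p * pderiv (f j))" for p
    by (simp add: L higher_pderiv_sum[of 1, simplified] pderiv_mult algebra_simps)
  then have eq: "(\<lambda>p. pderiv (L p)) =
      (\<lambda>p. \<Sum>j\<le>r. (pderiv ^^ Suc j) p * f j + (pderiv ^^ j) p * pderiv (f j))"
    by blast
  show ?thesis unfolding eq
    by (intro scalar_diff_ops_sum scalar_diff_ops_add scalar_diff_ops_term)
qed

text \<open>
  Composition follows from closure under post-composition with the derivative (Leibniz rule) and
  under multiplication by polynomials; no formula for the coefficients of the product is used.
\<close>

lemma scalar_diff_ops_comp:
  assumes "L \<in> scalar_diff_ops" "M \<in> scalar_diff_ops"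
  shows "(\<lambda>p. M (L p)) \<in> scalar_diff_ops"
proof -
  obtain r f where M: "M = (\<lambda>p. \<Sum>j\<le>r. (pderiv ^^ j) p * f j)"
    using assms by (auto simp: scalar_diff_ops_def)
  have "(\<lambda>p. (pderiv ^^ j) (L p)) \<in> scalar_diff_ops" for j
    by (induction j) (auto simp: assms(1) scalar_diff_ops_pderiv)
  then show ?thesis unfolding M
    by (intro scalar_diff_ops_sum scalar_diff_ops_mult)
qed

lemma scalar_diff_ops_first_order: "(\<lambda>p. pderiv p * g + p * h) \<in> scalar_diff_ops"
  using scalar_diff_ops_add[OF scalar_diff_ops_term[of 1 g] scalar_diff_ops_term[of 0 h]] by simp

lemma scalar_diff_ops_id: "(\<lambda>p. p) \<in> scalar_diff_ops"
  using scalar_diff_ops_term[of 0 1] by simp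

lemma scalar_diff_op_linear:
  assumes "L \<in> scalar_diff_ops"
  shows "L (p + q) = L p + L q" "L (smult c p) = smult c (L p)" "L 0 = 0"
proof -
  have smult_sum_right: "smult c (sum h A) = (\<Sum>a\<in>A. smult c (h a))" for h and A :: "nat set"
    by (induction A rule: infinite_finite_induct) (auto simp: smult_add_right)
  show "L (p + q) = L p + L q" "L (smult c p) = smult c (L p)" "L 0 = 0"
    using assms
    by (auto simp: scalar_diff_ops_def higher_pderiv_add higher_pderiv_smult distrib_right
        sum.distrib smult_sum_right)
qed

section \<open>Orthogonal polynomials of a linear functional\<close>

definition is_monic_orth :: "(complex poly \<Rightarrow> complex) \<Rightarrow> nat \<Rightarrow> complex poly \<Rightarrow> bool" where
  "is_monic_orth L n p \<longleftrightarrow>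
     degree p = n \<and> coeff p n = 1 \<and> (\<forall>q. degree q < n \<longrightarrow> L (p * q) = 0)"

definition orth_poly :: "(complex poly \<Rightarrow> complex) \<Rightarrow> nat \<Rightarrow> complex poly" where
  "orth_poly L n = (THE p. is_monic_orth L n p)"

text \<open>
  The functional is complex linear and is paired as \<open>L (p * q)\<close>, so orthogonality needs no
  conjugation; the last two conditions say that \<open>(p, q) \<mapsto> L (p * map_poly cnj q)\<close> is a Hermitian
  form without nonzero isotropic vectors.  The integrals defining orthogonal matrix polynomials are
  values of this form.
\<close>

locale moment_functional =
  fixes L :: "complex poly \<Rightarrow> complex"
  assumes add: "L (p + q) = L p + L q"
    and smult: "L (smult c p) = c * L p"
    and hermitian: "L (p * map_poly cnj q) = cnj (L (q * map_poly cnj p))"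
    and definite: "p \<noteq> 0 \<Longrightarrow> L (p * map_poly cnj p) \<noteq> 0"
begin

lemma zero [simp]: "L 0 = 0"
  using smult[of 0 0] by simp

lemma diff: "L (p - q) = L p - L q"
  using add[of "p - q" q] by simp

text \<open>Such an \<open>f\<close> is orthogonal to its own conjugate, so it is isotropic.\<close>

lemma orth_lower_eq_0:
  assumes "degree f < n" "\<And>q. degree q < n \<Longrightarrow> L (f * q) = 0"
  shows "f = 0"
proof (rule ccontr)
  assume "f \<noteq> 0"
  moreover have "degree (map_poly cnj f) < n"
    using assms(1) by (simp add: degree_map_poly)
  ultimately show False using assms(2) definite by blast
qed

lemma monic_orth_unique:
  assumes "is_monic_orth L n p" "is_monic_orth L n q"
  shows "p = q"
proof -
  have "p = q \<or> degree (p - q) < n"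
    using assms by (intro coeff_eq_imp_lower_degree) (auto simp: is_monic_orth_def)
  moreover have "L ((p - q) * r) = 0" if "degree r < n" for r
    using assms that by (simp add: is_monic_orth_def left_diff_distrib diff)
  ultimately show ?thesis using orth_lower_eq_0[of "p - q" n] by auto
qed

text \<open>
  Definiteness only concerns \<open>p\<close> times its conjugate.  The conjugate is again monic of degree \<open>m\<close>,
  so it differs from \<open>p\<close> by a polynomial of lower degree, to which \<open>p\<close> is orthogonal.
\<close>

lemma monic_orth_square_nonzero:
  assumes "is_monic_orth L m p"
  shows "L (p * p) \<noteq> 0"
proof -
  have p: "degree p = m" "coeff p m = 1" "p \<noteq> 0" using assms by (auto simp: is_monic_orth_def)
  let ?c = "map_poly cnj p"
  have "p = ?c \<or> degree (p - ?c) < m"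
    using p by (intro coeff_eq_imp_lower_degree) (auto simp: degree_map_poly coeff_map_poly)
  then have "L (p * (p - ?c)) = 0" using assms by (auto simp: is_monic_orth_def)
  then have "L (p * p) = L (p * ?c)" by (simp add: right_diff_distrib diff)
  then show ?thesis using definite p by simp
qed

text \<open>
  Gram-Schmidt: starting from \<open>x\<^sup>n\<close>, one makes the polynomial orthogonal to all degrees below
  \<open>m = 0, 1, \<dots>, n\<close>, subtracting at each step a multiple of the orthogonal polynomial of degree \<open>m\<close>.
\<close>

lemma monic_orth_exists: "\<exists>p. is_monic_orth L n p"
proof (induction n rule: less_induct)
  case (less n)
  have "\<exists>p. degree p = n \<and> coeff p n = 1 \<and> (\<forall>q. degree q < m \<longrightarrow> L (p * q) = 0)"
    if "m \<le> n" for m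
    using that
  proof (induction m)
    case 0
    then show ?case by (intro exI[of _ "monom 1 n"]) (auto simp: degree_monom_eq)
  next
    case (Suc m)
    then obtain p where p: "degree p = n" "coeff p n = 1" "\<And>q. degree q < m \<Longrightarrow> L (p * q) = 0"
      by auto
    obtain b where b: "is_monic_orth L m b" using less[of m] Suc.prems by auto
    have b': "degree b = m" "coeff b m = 1" "\<And>q. degree q < m \<Longrightarrow> L (b * q) = 0"
      using b by (auto simp: is_monic_orth_def)
    define t where "t = L (p * b) / L (b * b)"
    define p' where "p' = p - smult t b"
    have lt: "degree (smult t b) < n" using b' Suc.prems by (simp add: le_less_trans[OF degree_smult_le])
    have "coeff p' n = 1" using lt p by (simp add: p'_def coeff_eq_0 b' Suc.prems[THEN Suc_le_lessD])
    moreover have "degree p' \<le> n" using p lt by (simp add: p'_def degree_diff_le)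
    ultimately have "degree p' = n" by (metis le_degree le_antisym zero_neq_one)
    moreover have "L (p' * q) = 0" if q: "degree q < Suc m" for q
    proof -
      define r where "r = q - smult (coeff q m) b"
      have "degree (smult (coeff q m) b) \<le> m" using b' by (simp add: order_trans[OF degree_smult_le])
      then have "q = smult (coeff q m) b \<or> degree r < m"
        unfolding r_def using q b' by (intro coeff_eq_imp_lower_degree) auto
      then have "L (p * r) = 0" "L (b * r) = 0" by (auto simp: r_def p b')
      moreover have "L (p' * b) = 0"
        using monic_orth_square_nonzero[OF b]
        by (simp add: p'_def t_def left_diff_distrib diff smult)
      moreover have "p' * q = p * r - smult t (b * r) + smult (coeff q m) (p' * b)"
        by (simp add: r_def p'_def algebra_simps smult_diff_right)
      ultimately show ?thesis by (simp add: add diff smult)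
    qed
    ultimately show ?case using \<open>coeff p' n = 1\<close> by auto
  qed
  from this[of n] show ?case by (auto simp: is_monic_orth_def)
qed

lemma orth_poly_is_monic_orth: "is_monic_orth L n (orth_poly L n)"
  unfolding orth_poly_def using monic_orth_exists monic_orth_unique by (metis theI)

lemma degree_orth_poly [simp]: "degree (orth_poly L n) = n"
  and coeff_orth_poly [simp]: "coeff (orth_poly L n) n = 1"
  and orth_poly_lower: "degree q < n \<Longrightarrow> L (orth_poly L n * q) = 0"
  using orth_poly_is_monic_orth[of n] by (auto simp: is_monic_orth_def)

lemma orth_poly_0 [simp]: "orth_poly L 0 = 1"
  using degree_orth_poly[of 0] coeff_orth_poly[of 0]
  by (metis coeff_pCons_0 degree_eq_zeroE one_pCons)

lemma orth_multiple:
  assumes "degree f \<le> n" "\<And>q. degree q < n \<Longrightarrow> L (f * q) = 0"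
  shows "f = smult (coeff f n) (orth_poly L n)"
proof -
  let ?g = "smult (coeff f n) (orth_poly L n)"
  have "f = ?g \<or> degree (f - ?g) < n"
    using assms by (intro coeff_eq_imp_lower_degree) (auto simp: order_trans[OF degree_smult_le])
  moreover have "L ((f - ?g) * q) = 0" if "degree q < n" for q
    using assms that by (simp add: left_diff_distrib diff smult orth_poly_lower)
  ultimately show ?thesis using orth_lower_eq_0[of "f - ?g" n] by auto
qed

lemma orth_poly_hermitian:
  assumes "n \<noteq> m"
  shows "L (orth_poly L n * map_poly cnj (orth_poly L m)) = 0"
proof -
  have *: "L (orth_poly L n * map_poly cnj (orth_poly L m)) = 0" if "m < n" for n m
    using that by (intro orth_poly_lower) (simp add: degree_map_poly)
  show ?thesis
  proof (cases "m < n")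
    case False
    then have "cnj (L (orth_poly L m * map_poly cnj (orth_poly L n))) = 0" using assms *[of n m] by simp
    then show ?thesis using hermitian[of "orth_poly L n" "orth_poly L m"] by metis
  qed (rule *)
qed

lemma agree_on_orth_poly:
  assumes "\<And>p q. M (p + q) = M p + M q" "\<And>c p. M (smult c p) = smult c (M p)"
    and "\<And>p q. M' (p + q) = M' p + M' q" "\<And>c p. M' (smult c p) = smult c (M' p)"
    and "\<And>n. M (orth_poly L n) = M' (orth_poly L n)"
  shows "M p = M' (p :: complex poly)"
proof (rule monic_sequence_induct[of "orth_poly L" "\<lambda>p. M p = M' p"])
  show "M 0 = M' 0" using assms(2)[of 0 0] assms(4)[of 0 0] by simp
qed (simp_all add: assms)

end

text \<open>
  This is the source of all intertwiners below: if \<open>V\<close> has an adjoint \<open>U\<close> and neither raises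
  degrees, then \<open>V p\<^sub>n\<close> is orthogonal to lower degrees with respect to \<open>L'\<close>, since \<open>p\<^sub>n\<close> is
  orthogonal to \<open>U q\<close>.
\<close>

lemma adjoint_maps_orth_poly:
  assumes "moment_functional L" "moment_functional L'"
    and adj: "\<And>p q. L' (V p * q) = L (p * U q)"
    and V: "\<And>p. degree (V p) \<le> degree p" and U: "\<And>q. degree (U q) \<le> degree q"
  shows "V (orth_poly L n) = smult (coeff (V (orth_poly L n)) n) (orth_poly L' n)"
proof -
  interpret L: moment_functional L by fact
  interpret L': moment_functional L' by fact
  show ?thesis
  proof (rule L'.orth_multiple)
    show "degree (V (orth_poly L n)) \<le> n" using V[of "orth_poly L n"] by simp
    show "L' (V (orth_poly L n) * q) = 0" if "degree q < n" for q
      using L.orth_poly_lower[of "U q" n] U[of q] that by (simp add: adj)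
  qed
qed

section \<open>The second-order operator of a Pearson functional\<close>

definition second_order_op :: "complex poly \<Rightarrow> complex poly \<Rightarrow> complex poly \<Rightarrow> complex poly" where
  "second_order_op \<phi> \<psi> p = \<phi> * pderiv (pderiv p) + \<psi> * pderiv p"

text \<open>The factor by which the operator multiplies the coefficient of \<open>x\<^sup>n\<close> of a polynomial of degree \<open>n\<close>.\<close>

definition eigenvalue :: "complex poly \<Rightarrow> complex poly \<Rightarrow> nat \<Rightarrow> complex" where
  "eigenvalue \<phi> \<psi> n = coeff \<phi> 2 * of_nat n * (of_nat n - 1) + coeff \<psi> 1 * of_nat n"

lemma second_order_op_linear:
  "second_order_op \<phi> \<psi> (p + q) = second_order_op \<phi> \<psi> p + second_order_op \<phi> \<psi> q"
  "second_order_op \<phi> \<psi> (smult c p) = smult c (second_order_op \<phi> \<psi> p)"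
  by (simp_all add: second_order_op_def pderiv_add pderiv_smult algebra_simps smult_add_right)

lemma coeff_second_order_op:
  assumes "degree \<phi> \<le> 2" "degree \<psi> \<le> 1"
  shows "coeff (second_order_op \<phi> \<psi> p) k = eigenvalue \<phi> \<psi> k * coeff p k
    + (of_nat k * coeff \<phi> 1 + coeff \<psi> 0) * of_nat (k + 1) * coeff p (k + 1)
    + coeff \<phi> 0 * of_nat (k + 1) * of_nat (k + 2) * coeff p (k + 2)"
proof -
  have "\<phi> = [:coeff \<phi> 0, coeff \<phi> 1, coeff \<phi> 2:]"
  proof (rule poly_eqI)
    show "coeff \<phi> n = coeff [:coeff \<phi> 0, coeff \<phi> 1, coeff \<phi> 2:] n" for n
      using assms(1) by (auto simp: coeff_pCons eval_nat_numeral coeff_eq_0 split: nat.splits)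
  qed
  moreover have "\<psi> = [:coeff \<psi> 0, coeff \<psi> 1:]"
  proof (rule poly_eqI)
    show "coeff \<psi> n = coeff [:coeff \<psi> 0, coeff \<psi> 1:] n" for n
      using assms(2) by (auto simp: coeff_pCons eval_nat_numeral coeff_eq_0 split: nat.splits)
  qed
  moreover have "coeff ([:a, b, c:] * pderiv (pderiv p) + [:d, e:] * pderiv p) k
    = (c * of_nat k * (of_nat k - 1) + e * of_nat k) * coeff p k
    + (of_nat k * b + d) * of_nat (k + 1) * coeff p (k + 1)
    + a * of_nat (k + 1) * of_nat (k + 2) * coeff p (k + 2)" for a b c d e
    by (cases k; cases "k - 1") (auto simp: coeff_pderiv coeff_pCons algebra_simps)
  ultimately show ?thesis
    unfolding second_order_op_def eigenvalue_def by metis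
qed

lemma degree_second_order_op:
  assumes "degree \<phi> \<le> 2" "degree \<psi> \<le> 1"
  shows "degree (second_order_op \<phi> \<psi> p) \<le> degree p"
  by (rule degree_le) (simp add: coeff_second_order_op[OF assms] coeff_eq_0)

text \<open>
  The Pearson equation \<open>(\<phi> w)' = \<psi> w\<close> of a weight, together with the vanishing of \<open>\<phi> w p\<close> at the end
  points, in its integrated form.  It makes the operator \<open>\<phi> d\<^sup>2 + \<psi> d\<close> symmetric.
\<close>

locale pearson_functional = moment_functional +
  fixes \<phi> \<psi> :: "complex poly"
  assumes degree_\<phi>: "degree \<phi> \<le> 2" and degree_\<psi>: "degree \<psi> \<le> 1"
    and pearson: "L (\<phi> * pderiv p + \<psi> * p) = 0"
begin

lemma second_order_op_symmetric:
  "L (second_order_op \<phi> \<psi> p * q) = L (p * second_order_op \<phi> \<psi> q)"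
proof -
  have "L (second_order_op \<phi> \<psi> p * q) = - L (\<phi> * pderiv p * pderiv q)" for p q
  proof -
    have "second_order_op \<phi> \<psi> p * q + \<phi> * pderiv p * pderiv q
        = \<phi> * pderiv (pderiv p * q) + \<psi> * (pderiv p * q)"
      by (simp add: second_order_op_def pderiv_mult algebra_simps)
    then have "L (second_order_op \<phi> \<psi> p * q) + L (\<phi> * pderiv p * pderiv q) = 0"
      using pearson by (metis add)
    then show ?thesis by (simp add: eq_neg_iff_add_eq_0)
  qed
  from this[of p q] this[of q p] show ?thesis by (simp add: mult_ac)
qed

lemma second_order_op_orth_poly:
  "second_order_op \<phi> \<psi> (orth_poly L n) = smult (eigenvalue \<phi> \<psi> n) (orth_poly L n)"
proof -
  have "moment_functional L" by unfold_locales
  from adjoint_maps_orth_poly[OF this this second_order_op_symmetric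
      degree_second_order_op degree_second_order_op, OF degree_\<phi> degree_\<psi> degree_\<phi> degree_\<psi>]
  have "second_order_op \<phi> \<psi> (orth_poly L n)
      = smult (coeff (second_order_op \<phi> \<psi> (orth_poly L n)) n) (orth_poly L n)"
    .
  also have "coeff (second_order_op \<phi> \<psi> (orth_poly L n)) n = eigenvalue \<phi> \<psi> n"
    by (simp add: coeff_second_order_op[OF degree_\<phi> degree_\<psi>] coeff_eq_0)
  finally show ?thesis .
qed

end

lemma pderiv_eq_0_of_degree_le_2: "degree \<phi> \<le> 2 \<Longrightarrow> pderiv (pderiv (pderiv (\<phi>::complex poly))) = 0"
  by (metis degree_pderiv diff_is_0_eq pderiv_eq_0_iff le_diff_conv one_add_one)

lemma pderiv_eq_0_of_degree_le_1: "degree \<psi> \<le> 1 \<Longrightarrow> pderiv (pderiv (\<psi>::complex poly)) = 0"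
  by (metis degree_pderiv diff_is_0_eq pderiv_eq_0_iff)

section \<open>Necessary conditions for an intertwiner\<close>

text \<open>
  Leibniz rule; the expansion stops after the second derivative of \<open>\<phi>\<close> and the first of \<open>\<psi>\<close>.
\<close>

lemma higher_pderiv_second_order_op:
  assumes "degree \<phi> \<le> 2" "degree \<psi> \<le> 1"
  shows "(pderiv ^^ j) (second_order_op \<phi> \<psi> p) = \<phi> * (pderiv ^^ (j + 2)) p
    + (of_nat j * pderiv \<phi> + \<psi>) * (pderiv ^^ (j + 1)) p
    + (of_nat (j choose 2) * pderiv (pderiv \<phi>) + of_nat j * pderiv \<psi>) * (pderiv ^^ j) p"
proof (induction j)
  case 0
  then show ?case by (simp add: second_order_op_def eval_nat_numeral)
next
  case (Suc j)
  have "(Suc j choose 2) = j + (j choose 2)" by (simp add: numeral_2_eq_2)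
  then show ?case
    using Suc assms by (simp add: pderiv_add pderiv_mult pderiv_eq_0_of_degree_le_2
        pderiv_eq_0_of_degree_le_1 algebra_simps)
qed

lemma poly_higher_pderiv_shifted_power:
  "poly ((pderiv ^^ j) ([:- c, 1:] ^ m)) c = (if j = m then fact m else (0::complex))"
proof (induction m arbitrary: j)
  case 0
  show ?case by (cases j) (simp_all add: funpow_Suc_right pderiv_1 del: funpow.simps(2))
next
  case (Suc m)
  show ?case
  proof (cases j)
    case (Suc i)
    have "pderiv ([:- c, 1:] ^ Suc m) = smult (of_nat (Suc m)) ([:- c, 1:] ^ m)"
      by (subst pderiv_power_Suc) (simp add: pderiv_pCons)
    then have "(pderiv ^^ j) ([:- c, 1:] ^ Suc m)
        = smult (of_nat (Suc m)) ((pderiv ^^ i) ([:- c, 1:] ^ m))"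
      by (simp only: Suc funpow_Suc_right o_apply higher_pderiv_smult)
    then show ?thesis using Suc.IH[of i] Suc by simp
  qed simp
qed

text \<open>
  In \<open>V \<circ> \<delta> - \<delta>' \<circ> V\<close>, where \<open>V\<close> has order \<open>r\<close> and leading coefficient \<open>g\<close>, the terms of order
  \<open>r + 2\<close> cancel because both operators have the same \<open>\<phi>\<close>.  Of the coefficient of order \<open>r + 1\<close> there
  remains \<open>g (r \<phi>' + \<psi> - \<psi>') - 2 \<phi> g'\<close>.
\<close>

lemma principal_coefficient_equation:
  assumes V: "V \<in> scalar_diff_ops" "V p\<^sub>0 \<noteq> 0"
    and deg: "degree \<phi> \<le> 2" "degree \<psi> \<le> 1" "degree \<psi>' \<le> 1"
    and comm: "\<And>p. V (second_order_op \<phi> \<psi> p) = second_order_op \<phi> \<psi>' (V p)"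
  obtains r g where "g \<noteq> 0" "g * (of_nat r * pderiv \<phi> + (\<psi> - \<psi>')) = 2 * \<phi> * pderiv g"
proof -
  obtain R f where R: "\<And>S p. R \<le> S \<Longrightarrow> V p = (\<Sum>j\<le>S. (pderiv ^^ j) p * f j)"
    and f0: "\<And>j. R < j \<Longrightarrow> f j = 0"
    using scalar_diff_ops_padE[OF V(1)] by metis
  define J where "J = {j. f j \<noteq> 0}"
  have "J \<subseteq> {..R}" using f0 by (auto simp: J_def not_less[symmetric])
  then have "finite J" by (rule finite_subset) simp
  moreover have "J \<noteq> {}"
  proof
    assume "J = {}"
    then have "f j = 0" for j by (auto simp: J_def)
    then show False using V(2) R[OF order_refl] by simp
  qed
  ultimately have Max: "Max J \<in> J" by simp
  define r where "r = Max J"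
  have "f r \<noteq> 0" "r \<le> R" using Max \<open>J \<subseteq> {..R}\<close> by (auto simp: J_def r_def)
  moreover have "f j = 0" if "r < j" for j
    using Max_ge[OF \<open>finite J\<close>, of j] that by (auto simp: J_def r_def)
  ultimately have r: "f r \<noteq> 0" "\<And>j. r < j \<Longrightarrow> f j = 0" and "r \<le> R" by auto
  have Vr: "V p = (\<Sum>j\<le>r. (pderiv ^^ j) p * f j)" for p
    unfolding R[OF order_refl] using \<open>r \<le> R\<close> r by (intro sum.mono_neutral_right) auto
  define e where "e j = f j * (of_nat j * pderiv \<phi> + (\<psi> - \<psi>')) - 2 * \<phi> * pderiv (f j)" for j
  define d where "d j = f j * (of_nat (j choose 2) * pderiv (pderiv \<phi>) + of_nat j * pderiv \<psi>)
      - \<phi> * pderiv (pderiv (f j)) - \<psi>' * pderiv (f j)" for j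
  have "(\<Sum>j\<le>r. (pderiv ^^ Suc j) p * e j + (pderiv ^^ j) p * d j) = 0" for p
  proof -
    have "second_order_op \<phi> \<psi>' (V p)
        = (\<Sum>j\<le>r. second_order_op \<phi> \<psi>' ((pderiv ^^ j) p * f j))"
      unfolding Vr by (simp add: second_order_op_def higher_pderiv_sum[of 1, simplified]
          sum_distrib_left sum.distrib)
    then have "(\<Sum>j\<le>r. (pderiv ^^ j) (second_order_op \<phi> \<psi> p) * f j
        - second_order_op \<phi> \<psi>' ((pderiv ^^ j) p * f j)) = 0"
      using comm[of p] by (simp add: Vr sum_subtractf)
    moreover have "(pderiv ^^ j) (second_order_op \<phi> \<psi> p) * f j
        - second_order_op \<phi> \<psi>' ((pderiv ^^ j) p * f j)
        = (pderiv ^^ Suc j) p * e j + (pderiv ^^ j) p * d j" for j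
      unfolding higher_pderiv_second_order_op[OF deg(1,2)] e_def d_def
      by (simp add: second_order_op_def pderiv_mult pderiv_add algebra_simps)
    ultimately show ?thesis by simp
  qed
  note vanish = this
  have "poly (e r) c = 0" for c
  proof -
    \<comment> \<open>At \<open>c\<close>, this power of \<open>x - c\<close> has a nonzero derivative in the single order \<open>r + 1\<close>, so it isolates
      \<open>e r\<close>.\<close>
    let ?X = "[:- c, 1:] ^ Suc r"
    have "0 = poly (\<Sum>j\<le>r. (pderiv ^^ Suc j) ?X * e j + (pderiv ^^ j) ?X * d j) c"
      by (simp only: vanish poly_0)
    also have "\<dots> = (\<Sum>j\<le>r. if j = r then fact (Suc r) * poly (e j) c else 0)"
      by (simp only: poly_sum poly_add poly_mult poly_higher_pderiv_shifted_power)
        (intro sum.cong, auto)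
    finally have "fact (Suc r) * poly (e r) c = 0" by (simp del: fact_Suc)
    then show ?thesis by (simp del: fact_Suc)
  qed
  then have "e r = 0" by (intro poly_eq_poly_eq_iff[THEN iffD1]) (auto simp: fun_eq_iff)
  then show thesis using r by (intro that[of "f r" r]) (auto simp: e_def)
qed

definition intertwines ::
  "(complex poly \<Rightarrow> complex) \<Rightarrow> (complex poly \<Rightarrow> complex) \<Rightarrow> (complex poly \<Rightarrow> complex poly) \<Rightarrow> bool" where
  "intertwines L L' V \<longleftrightarrow> V \<in> scalar_diff_ops \<and> (\<forall>n. \<exists>a. V (orth_poly L n) = smult a (orth_poly L' n))"

text \<open>
  The linear coefficient of \<open>\<psi>\<close>, together with \<open>\<phi>\<close>, determines the eigenvalues.  If they agree, both
  sides agree on every \<open>p\<^sub>n\<close>.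
\<close>

lemma intertwines_commutes:
  assumes "pearson_functional L \<phi> \<psi>" "pearson_functional L' \<phi> \<psi>'"
    and "coeff \<psi> 1 = coeff \<psi>' 1" and V: "intertwines L L' V"
  shows "V (second_order_op \<phi> \<psi> p) = second_order_op \<phi> \<psi>' (V p)"
proof -
  interpret L: pearson_functional L \<phi> \<psi> by fact
  interpret L': pearson_functional L' \<phi> \<psi>' by fact
  have V': "V \<in> scalar_diff_ops" using V by (simp add: intertwines_def)
  show ?thesis
  proof (rule L.agree_on_orth_poly[of "\<lambda>p. V (second_order_op \<phi> \<psi> p)" "\<lambda>p. second_order_op \<phi> \<psi>' (V p)"])
    fix n
    obtain a where "V (orth_poly L n) = smult a (orth_poly L' n)"
      using V by (auto simp: intertwines_def)
    moreover have "eigenvalue \<phi> \<psi> n = eigenvalue \<phi> \<psi>' n" using assms(3) by (simp add: eigenvalue_def)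
    ultimately show "V (second_order_op \<phi> \<psi> (orth_poly L n))
        = second_order_op \<phi> \<psi>' (V (orth_poly L n))"
      by (simp add: L.second_order_op_orth_poly L'.second_order_op_orth_poly
          scalar_diff_op_linear[OF V'] second_order_op_linear mult.commute)
  qed (simp_all add: second_order_op_linear scalar_diff_op_linear[OF V'])
qed

text \<open>
  Differentiating \<open>\<delta> p = \<mu> p\<close> repeatedly at a zero \<open>c\<close> of \<open>\<phi>\<close> gives a two-term recursion for the
  Taylor coefficients of \<open>p\<close> at \<open>c\<close>, so that they are polynomials in \<open>\<mu>\<close>, independent of \<open>p\<close>,
  times \<open>p(c)\<close>.  By the regularity assumption the recursion can be solved.
\<close>

lemma eigenpoly_derivative_at_singular_point:
  assumes deg: "degree \<phi> \<le> 2" "degree \<psi> \<le> 1" and "poly \<phi> c = 0"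
    and regular: "\<And>k. of_nat k * poly (pderiv \<phi>) c + poly \<psi> c \<noteq> 0"
  shows "\<exists>T. \<forall>p \<mu>. second_order_op \<phi> \<psi> p = smult \<mu> p \<longrightarrow>
    poly ((pderiv ^^ k) p) c = poly T \<mu> * poly p c"
proof (induction k)
  case 0
  show ?case by (rule exI[of _ 1]) simp
next
  case (Suc k)
  then obtain T where T: "\<And>p \<mu>. second_order_op \<phi> \<psi> p = smult \<mu> p \<Longrightarrow>
    poly ((pderiv ^^ k) p) c = poly T \<mu> * poly p c" by auto
  define u where "u = of_nat k * poly (pderiv \<phi>) c + poly \<psi> c"
  define v where "v = of_nat (k choose 2) * poly (pderiv (pderiv \<phi>)) c + of_nat k * poly (pderiv \<psi>) c"
  have "u \<noteq> 0" using regular by (simp add: u_def)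
  show ?case
  proof (intro exI allI impI)
    fix p \<mu> assume p: "second_order_op \<phi> \<psi> p = smult \<mu> p"
    have "poly ((pderiv ^^ k) (second_order_op \<phi> \<psi> p)) c = \<mu> * poly ((pderiv ^^ k) p) c"
      by (simp add: p higher_pderiv_smult)
    then have "u * poly ((pderiv ^^ Suc k) p) c = (\<mu> - v) * poly ((pderiv ^^ k) p) c"
      unfolding higher_pderiv_second_order_op[OF deg]
      by (simp add: \<open>poly \<phi> c = 0\<close> u_def v_def algebra_simps)
    then show "poly ((pderiv ^^ Suc k) p) c = poly (smult (1 / u) ([:- v, 1:] * T)) \<mu> * poly p c"
      using \<open>u \<noteq> 0\<close> T[OF p] by (simp add: field_simps)
  qed
qed

text \<open>The value of \<open>V p\<close> at \<open>c\<close> is a combination of derivatives of \<open>p\<close> there.\<close>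

lemma diff_op_eigenpoly_at_singular_point:
  assumes deg: "degree \<phi> \<le> 2" "degree \<psi> \<le> 1" and "poly \<phi> c = 0"
    and regular: "\<And>k. of_nat k * poly (pderiv \<phi>) c + poly \<psi> c \<noteq> 0"
    and V: "V \<in> scalar_diff_ops"
  obtains A where "\<And>p \<mu>. second_order_op \<phi> \<psi> p = smult \<mu> p \<Longrightarrow> poly (V p) c = poly A \<mu> * poly p c"
proof -
  obtain r f where f: "V = (\<lambda>p. \<Sum>j\<le>r. (pderiv ^^ j) p * f j)"
    using V by (auto simp: scalar_diff_ops_def)
  obtain T where T: "\<And>k p \<mu>. second_order_op \<phi> \<psi> p = smult \<mu> p \<Longrightarrow>
      poly ((pderiv ^^ k) p) c = poly (T k) \<mu> * poly p c"
    using eigenpoly_derivative_at_singular_point[OF assms(1-4)] by metis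
  show thesis
    by (rule that[of "\<Sum>j\<le>r. smult (poly (f j) c) (T j)"])
      (simp add: f poly_sum T sum_distrib_right sum_distrib_left mult_ac)
qed

lemma poly_eq_on_nats:
  assumes "\<And>n. poly p (of_nat n) = poly q (of_nat n :: complex)"
  shows "p = q"
proof (rule ccontr)
  assume "p \<noteq> q"
  then have "finite {x. poly (p - q) x = 0}" by (intro poly_roots_finite) simp
  moreover have "range of_nat \<subseteq> {x. poly (p - q) x = 0}" using assms by auto
  ultimately have "finite (range (of_nat :: nat \<Rightarrow> complex))" by (rule finite_subset[rotated])
  then show False by (simp add: finite_image_iff inj_on_def)
qed

text \<open>
  The first-order coefficient of the Jacobi differential equation, whose second-order coefficient is
  \<open>1 - x\<^sup>2\<close>.
\<close>

definition jacobi_\<psi> :: "real \<Rightarrow> real \<Rightarrow> complex poly" where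
  "jacobi_\<psi> \<alpha> \<beta> = [:of_real (\<beta> - \<alpha>), - of_real (\<alpha> + \<beta> + 2):]"

text \<open>
  By \<open>diff_op_eigenpoly_at_singular_point\<close>, \<open>(V p\<^sub>n)(1) = A(\<lambda>\<^sub>n) p\<^sub>n(1)\<close> and
  \<open>(V p\<^sub>n)'(1) = B(\<lambda>\<^sub>n) p\<^sub>n(1)\<close> with polynomials \<open>A\<close>, \<open>B\<close>.  As \<open>V p\<^sub>n\<close> is a multiple of \<open>p'\<^sub>n\<close>, the
  differential equation of \<open>p'\<^sub>n\<close> at \<open>1\<close> gives \<open>k B(\<lambda>\<^sub>n) = \<lambda>'\<^sub>n A(\<lambda>\<^sub>n)\<close> with a constant \<open>k\<close>.  This
  holds for all \<open>n\<close>, hence as an identity of polynomials in \<open>n\<close>.  As \<open>\<lambda>\<close> is invariant under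
  \<open>n \<mapsto> - n - s - 1\<close>, where \<open>s = \<alpha> + \<beta>\<close>, and \<open>A\<close> is
  nonzero, \<open>\<lambda>'\<close> has the same symmetry, which means \<open>s' = s\<close>.
\<close>

lemma jacobi_intertwiner_same_sum:
  fixes \<alpha> \<beta> \<alpha>' \<beta>' :: real
  assumes L: "pearson_functional L [:1, 0, -1:] (jacobi_\<psi> \<alpha> \<beta>)"
    and L': "pearson_functional L' [:1, 0, -1:] (jacobi_\<psi> \<alpha>' \<beta>')"
    and gt: "\<alpha> > -1" "\<alpha>' > -1"
    and V: "intertwines L L' V" "V p\<^sub>0 \<noteq> 0"
  shows "\<alpha> + \<beta> = \<alpha>' + \<beta>'"
proof -
  interpret L: pearson_functional L "[:1, 0, -1:]" "jacobi_\<psi> \<alpha> \<beta>" by fact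
  interpret L': pearson_functional L' "[:1, 0, -1:]" "jacobi_\<psi> \<alpha>' \<beta>'" by fact
  let ?\<phi> = "[:1, 0, -1:] :: complex poly"
  let ?p = "orth_poly L" and ?p' = "orth_poly L'"
  have V': "V \<in> scalar_diff_ops" using V by (simp add: intertwines_def)
  have reg: "of_nat k * poly (pderiv ?\<phi>) 1 + poly (jacobi_\<psi> \<alpha> \<beta>) 1 \<noteq> 0"
    if "\<alpha> > -1" for k \<alpha> \<beta>
  proof -
    have "of_nat k * poly (pderiv ?\<phi>) 1 + poly (jacobi_\<psi> \<alpha> \<beta>) 1
        = complex_of_real (- 2 * (real k + (\<alpha> + 1)))"
      by (simp add: jacobi_\<psi>_def pderiv_pCons algebra_simps)
    also have "\<dots> \<noteq> 0" using that by (simp only: of_real_eq_0_iff) (simp add: add_nonneg_eq_0_iff)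
    finally show ?thesis .
  qed
  \<comment> \<open>The eigenvalues \<open>- n (n + s + 1)\<close> as a polynomial in \<open>n\<close>.\<close>
  define l where "l s = [:0, - of_real (s + 1), -1 :: complex:]" for s :: real
  have l: "eigenvalue ?\<phi> (jacobi_\<psi> \<alpha> \<beta>) n = poly (l (\<alpha> + \<beta>)) (of_nat n)" for \<alpha> \<beta> n
    by (simp add: eigenvalue_def l_def jacobi_\<psi>_def eval_nat_numeral algebra_simps)
  let ?s = "\<alpha> + \<beta>" and ?s' = "\<alpha>' + \<beta>'"
  obtain A where A: "\<And>p \<mu>. second_order_op ?\<phi> (jacobi_\<psi> \<alpha> \<beta>) p = smult \<mu> p \<Longrightarrow>
      poly (V p) 1 = poly A \<mu> * poly p 1"
    using diff_op_eigenpoly_at_singular_point[OF L.degree_\<phi> L.degree_\<psi> _ reg V'] gt by auto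
  obtain B where B: "\<And>p \<mu>. second_order_op ?\<phi> (jacobi_\<psi> \<alpha> \<beta>) p = smult \<mu> p \<Longrightarrow>
      poly (pderiv (V p)) 1 = poly B \<mu> * poly p 1"
    using diff_op_eigenpoly_at_singular_point[OF L.degree_\<phi> L.degree_\<psi> _ reg
        scalar_diff_ops_pderiv[OF V']] gt by auto
  have nz: "poly (orth_poly M n) 1 \<noteq> 0"
    if "pearson_functional M ?\<phi> (jacobi_\<psi> \<alpha> \<beta>)" "\<alpha> > -1" for M \<alpha> \<beta> n
  proof
    interpret M: pearson_functional M ?\<phi> "jacobi_\<psi> \<alpha> \<beta>" by fact
    assume 0: "poly (orth_poly M n) 1 = 0"
    have "poly ((pderiv ^^ n) (orth_poly M n)) 1 = 0"
      using eigenpoly_derivative_at_singular_point[OF M.degree_\<phi> M.degree_\<psi> _ reg, of n]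
        M.second_order_op_orth_poly[of n] 0 that by auto
    moreover have "degree ((pderiv ^^ n) (orth_poly M n)) = 0" by (simp add: degree_higher_pderiv)
    moreover have "coeff ((pderiv ^^ n) (orth_poly M n)) 0 \<noteq> 0"
      by (simp add: coeff_higher_pderiv pochhammer_fact[symmetric])
    ultimately show False by (auto elim!: degree_eq_zeroE)
  qed
  define k where "k = poly (jacobi_\<psi> \<alpha>' \<beta>') 1"
  have key: "k * poly B (poly (l ?s) (of_nat n)) = poly (l ?s') (of_nat n) * poly A (poly (l ?s) (of_nat n))" for n
  proof -
    obtain a where a: "V (?p n) = smult a (?p' n)" using V by (auto simp: intertwines_def)
    have "poly (second_order_op ?\<phi> (jacobi_\<psi> \<alpha>' \<beta>') (?p' n)) 1 = poly (l ?s') (of_nat n) * poly (?p' n) 1"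
      by (simp add: L'.second_order_op_orth_poly l)
    then have "k * poly (pderiv (?p' n)) 1 = poly (l ?s') (of_nat n) * poly (?p' n) 1"
      by (simp add: second_order_op_def k_def)
    then have "k * poly (pderiv (V (?p n))) 1 = poly (l ?s') (of_nat n) * poly (V (?p n)) 1"
      by (simp add: a pderiv_smult)
    then show ?thesis
      using A[OF L.second_order_op_orth_poly[of n]] B[OF L.second_order_op_orth_poly[of n]] nz[OF L gt(1), of n]
      by (simp add: l)
  qed
  have "A \<noteq> 0"
  proof
    assume "A = 0"
    have V0: "V (?p n) = 0" for n
    proof -
      obtain a where a: "V (?p n) = smult a (?p' n)" using V by (auto simp: intertwines_def)
      have "poly (V (?p n)) 1 = 0"
        using A[OF L.second_order_op_orth_poly[of n]] \<open>A = 0\<close> by simp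
      then show ?thesis using nz[OF L' gt(2), of n] by (simp add: a)
    qed
    have "V p = 0" for p
      by (rule L.agree_on_orth_poly[of V "\<lambda>_. 0"]) (simp_all add: V0 scalar_diff_op_linear[OF V'])
    then show False using V by simp
  qed
  \<comment> \<open>The reflection \<open>z \<mapsto> - z - s - 1\<close>, under which \<open>l s\<close> is invariant.\<close>
  let ?\<rho> = "[:- of_real (?s + 1), -1 :: complex:]"
  have "smult k (B \<circ>\<^sub>p l ?s) = l ?s' * (A \<circ>\<^sub>p l ?s)"
    by (rule poly_eq_on_nats) (simp add: poly_pcompose key)
  then have id: "k * poly B (poly (l ?s) z) = poly (l ?s') z * poly A (poly (l ?s) z)" for z
    by (metis poly_mult poly_pcompose poly_smult)
  have sym: "poly (l ?s) (poly ?\<rho> z) = poly (l ?s) z" for z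
    by (simp add: l_def algebra_simps)
  have "poly ((l ?s' \<circ>\<^sub>p ?\<rho> - l ?s') * (A \<circ>\<^sub>p l ?s)) z = 0" for z
    using id[of z] id[of "poly ?\<rho> z"] unfolding sym by (simp add: poly_pcompose left_diff_distrib)
  then have "(l ?s' \<circ>\<^sub>p ?\<rho> - l ?s') * (A \<circ>\<^sub>p l ?s) = 0"
    by (intro poly_eq_poly_eq_iff[THEN iffD1]) (auto simp: fun_eq_iff)
  moreover have "A \<circ>\<^sub>p l ?s \<noteq> 0"
    using \<open>A \<noteq> 0\<close> pcompose_eq_0[of A "l ?s"] by (auto simp: l_def)
  ultimately have refl: "poly (l ?s') (poly ?\<rho> z) = poly (l ?s') z" for z
    by (metis eq_iff_diff_eq_0 mult_eq_0_iff poly_pcompose)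
  \<comment> \<open>The point \<open>0\<close> settles the case \<open>s \<noteq> -1\<close>; the point \<open>1\<close> is needed for \<open>s = -1\<close>, where \<open>0\<close> is fixed
    by the reflection.\<close>
  from refl[of 0] have "complex_of_real ((?s + 1) * (?s' - ?s)) = 0"
    by (simp add: l_def algebra_simps)
  then have 1: "(?s + 1) * (?s' - ?s) = 0" by (simp only: of_real_eq_0_iff)
  from refl[of 1] have "complex_of_real ((?s + 2) * (?s' - ?s - 1) + ?s' + 2) = 0"
    by (simp add: l_def algebra_simps)
  then have 2: "(?s + 2) * (?s' - ?s - 1) + ?s' + 2 = 0" by (simp only: of_real_eq_0_iff)
  from 1 2 show ?thesis by (cases "?s + 1 = 0") (auto simp: algebra_simps)
qed

text \<open>
  The equation of the leading coefficient reads \<open>(b - b') g = g'\<close>, which has no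
  nonzero polynomial solution unless \<open>b = b'\<close>, by comparing degrees.
\<close>

lemma hermite_intertwiner:
  assumes L: "pearson_functional L 1 [:of_real (2 * b), -2:]"
    and L': "pearson_functional L' 1 [:of_real (2 * b'), -2:]"
    and V: "intertwines L L' V" "V p\<^sub>0 \<noteq> 0"
  shows "b = b'"
proof -
  interpret L: pearson_functional L 1 "[:of_real (2 * b), -2:]" by fact
  interpret L': pearson_functional L' 1 "[:of_real (2 * b'), -2:]" by fact
  have c: "coeff [:of_real (2 * b), -2:] 1 = coeff [:of_real (2 * b'), -2 :: complex:] 1" by simp
  have V': "V \<in> scalar_diff_ops" using V by (simp add: intertwines_def)
  obtain r and g :: "complex poly" where g: "g \<noteq> 0"
    "g * (of_nat r * pderiv 1 + ([:of_real (2 * b), -2:] - [:of_real (2 * b'), -2:])) = 2 * 1 * pderiv g"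
    by (rule principal_coefficient_equation[OF V' V(2) L.degree_\<phi> L.degree_\<psi> L'.degree_\<psi>
        intertwines_commutes[OF L L' c V(1)]])
  then have "smult (of_real (2 * (b - b'))) g = 2 * pderiv g"
    by (simp add: pderiv_1 algebra_simps)
  then have "of_real (2 * (b - b')) * coeff g (degree g) = 2 * coeff (pderiv g) (degree g)"
    by (metis coeff_smult mult_2 coeff_add)
  also have "coeff (pderiv g) (degree g) = 0" by (simp add: coeff_pderiv coeff_eq_0)
  finally have "complex_of_real (2 * (b - b')) = 0" using g(1) by simp
  then show ?thesis by (simp only: of_real_eq_0_iff) simp
qed

text \<open>
  The equation of the leading coefficient reads \<open>(r + \<alpha> - \<alpha>') g = 2 x g'\<close>; comparing the terms of
  highest degree, \<open>r + \<alpha> - \<alpha>'\<close> is twice the degree of \<open>g\<close>.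
\<close>

lemma laguerre_intertwiner:
  assumes L: "pearson_functional L [:0, 1:] [:of_real (\<alpha> + 1), -1:]"
    and L': "pearson_functional L' [:0, 1:] [:of_real (\<alpha>' + 1), -1:]"
    and V: "intertwines L L' V" "V p\<^sub>0 \<noteq> 0"
  shows "\<alpha>' - \<alpha> \<in> \<int>"
proof -
  interpret L: pearson_functional L "[:0, 1:]" "[:of_real (\<alpha> + 1), -1:]" by fact
  interpret L': pearson_functional L' "[:0, 1:]" "[:of_real (\<alpha>' + 1), -1:]" by fact
  have c: "coeff [:of_real (\<alpha> + 1), -1:] 1 = coeff [:of_real (\<alpha>' + 1), -1 :: complex:] 1" by simp
  have V': "V \<in> scalar_diff_ops" using V by (simp add: intertwines_def)
  obtain r and g :: "complex poly" where g: "g \<noteq> 0"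
    "g * (of_nat r * pderiv [:0, 1:] + ([:of_real (\<alpha> + 1), -1:] - [:of_real (\<alpha>' + 1), -1:]))
      = 2 * [:0, 1:] * pderiv g"
    by (rule principal_coefficient_equation[OF V' V(2) L.degree_\<phi> L.degree_\<psi> L'.degree_\<psi>
        intertwines_commutes[OF L L' c V(1)]])
  have "of_nat r * pderiv [:0, 1:] + ([:of_real (\<alpha> + 1), -1:] - [:of_real (\<alpha>' + 1), -1:])
      = [:complex_of_real (real r + \<alpha> - \<alpha>'):]"
    by (simp add: pderiv_pCons of_nat_poly)
  then have "smult (of_real (real r + \<alpha> - \<alpha>')) g = smult 2 (pCons 0 (pderiv g))"
    using g(2) by (simp add: numeral_poly)
  then have "of_real (real r + \<alpha> - \<alpha>') * coeff g (degree g)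
      = 2 * coeff (pCons 0 (pderiv g)) (degree g)"
    by (metis coeff_smult)
  also have "coeff (pCons 0 (pderiv g)) (degree g) = of_nat (degree g) * coeff g (degree g)"
    by (cases "degree g") (simp_all add: coeff_pderiv)
  finally have "complex_of_real (real r + \<alpha> - \<alpha>') = of_real (2 * real (degree g))"
    using g(1) by simp
  then have "real r + \<alpha> - \<alpha>' = 2 * real (degree g)" by (simp only: of_real_eq_iff)
  then have "\<alpha>' - \<alpha> = of_int (int r - 2 * int (degree g))" by simp
  then show ?thesis by (metis Ints_of_int)
qed

text \<open>
  If the leading coefficient \<open>g\<close> of \<open>V\<close> has a zero of order \<open>k\<close> at \<open>1\<close>, then dividing its
  equation by \<open>(x - 1)\<^sup>k\<close> and evaluating at \<open>1\<close> gives \<open>\<alpha>' - \<alpha> = r - 2 k\<close>, where \<open>r\<close> is the order of \<open>V\<close>.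
\<close>

lemma jacobi_intertwiner:
  assumes L: "pearson_functional L [:1, 0, -1:] (jacobi_\<psi> \<alpha> \<beta>)"
    and L': "pearson_functional L' [:1, 0, -1:] (jacobi_\<psi> \<alpha>' \<beta>')"
    and sum: "\<alpha> + \<beta> = \<alpha>' + \<beta>'"
    and V: "intertwines L L' V" "V p\<^sub>0 \<noteq> 0"
  shows "\<alpha>' - \<alpha> \<in> \<int>"
proof -
  interpret L: pearson_functional L "[:1, 0, -1:]" "jacobi_\<psi> \<alpha> \<beta>" by fact
  interpret L': pearson_functional L' "[:1, 0, -1:]" "jacobi_\<psi> \<alpha>' \<beta>'" by fact
  have c: "coeff (jacobi_\<psi> \<alpha> \<beta>) 1 = coeff (jacobi_\<psi> \<alpha>' \<beta>') 1"
    using sum by (simp add: jacobi_\<psi>_def)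
  have V': "V \<in> scalar_diff_ops" using V by (simp add: intertwines_def)
  obtain r and g :: "complex poly" where g: "g \<noteq> 0"
    "g * (of_nat r * pderiv [:1, 0, -1:] + (jacobi_\<psi> \<alpha> \<beta> - jacobi_\<psi> \<alpha>' \<beta>'))
      = 2 * [:1, 0, -1:] * pderiv g"
    by (rule principal_coefficient_equation[OF V' V(2) L.degree_\<phi> L.degree_\<psi> L'.degree_\<psi>
        intertwines_commutes[OF L L' c V(1)]])
  define E where "E = of_nat r * pderiv [:1, 0, -1:] + (jacobi_\<psi> \<alpha> \<beta> - jacobi_\<psi> \<alpha>' \<beta>')"
  obtain h where h: "g = [:-1, 1:] ^ order 1 g * h" "\<not> [:-1, 1:] dvd h"
    using order_decomp[OF g(1), of 1] by auto
  define k where "k = order 1 g"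
  have "poly h 1 \<noteq> 0" using h(2) by (simp add: poly_eq_0_iff_dvd)
  define X where "X = [:-1, 1 :: complex:]"
  define Y where "Y = [:1, 1 :: complex:]"
  have gk: "g = X ^ k * h" using h(1) by (simp add: k_def X_def)
  have \<phi>: "[:1, 0, -1:] = - (Y * X)" by (simp add: X_def Y_def)
  have "pderiv X = 1" by (simp add: X_def pderiv_pCons one_pCons)
  then have "X * pderiv (X ^ k) = of_nat k * X ^ k"
    by (cases k) (auto simp: pderiv_1 pderiv_power_Suc of_nat_poly simp del: power_Suc, simp add: mult_ac)
  then have Xg: "X * pderiv g = X ^ k * (of_nat k * h + X * pderiv h)"
    by (simp add: gk pderiv_mult algebra_simps)
  have "X ^ k * (h * E) = g * E" by (simp add: gk mult_ac)
  also have "\<dots> = - 2 * Y * (X * pderiv g)"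
    using g(2) unfolding E_def \<phi>[symmetric] by (simp only: \<phi>) (simp add: mult_ac)
  also have "\<dots> = X ^ k * (- 2 * Y * (of_nat k * h + X * pderiv h))"
    unfolding Xg by (simp add: mult_ac)
  finally have "X ^ k * (h * E) = \<dots>" .
  moreover have "X ^ k \<noteq> 0" by (simp add: X_def)
  ultimately have "h * E = - 2 * Y * (of_nat k * h + X * pderiv h)" by (metis mult_left_cancel)
  then have "poly h 1 * poly E 1 = poly (- 2 * Y * (of_nat k * h + X * pderiv h)) 1"
    by (metis poly_mult)
  then have "poly h 1 * poly E 1 = poly h 1 * (- 4 * of_nat k)"
    by (simp add: X_def Y_def)
  then have "poly E 1 = - 4 * of_nat k"
    using \<open>poly h 1 \<noteq> 0\<close> by (metis mult_left_cancel)
  also have "poly E 1 = of_real (2 * (\<alpha>' - \<alpha> - real r))"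
  proof -
    have b: "\<beta> = \<alpha>' + \<beta>' - \<alpha>" using sum by simp
    show ?thesis unfolding E_def jacobi_\<psi>_def b by (simp add: pderiv_pCons algebra_simps)
  qed
  finally have "complex_of_real (2 * (\<alpha>' - \<alpha> - real r)) = of_real (- 4 * real k)" by simp
  then have "2 * (\<alpha>' - \<alpha> - real r) = - 4 * real k" by (simp only: of_real_eq_iff)
  then have "\<alpha>' - \<alpha> = of_int (int r - 2 * int k)" by simp
  then show ?thesis by (metis Ints_of_int)
qed

section \<open>Degree-preserving intertwiners\<close>

definition preserves_degree :: "(complex poly \<Rightarrow> complex poly) \<Rightarrow> bool" where
  "preserves_degree V \<longleftrightarrow> (\<forall>p. (V p = 0 \<longleftrightarrow> p = 0) \<and> degree (V p) = degree p)"

text \<open>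
  For scalar weights this is the Darboux relation in a symmetric form: \<open>p\<^sub>n\<close> is an eigenfunction of
  the composite of \<open>V\<close> and \<open>N\<close>.  Symmetry and transitivity make it easy to iterate elementary steps.
\<close>

definition intertwined :: "(complex poly \<Rightarrow> complex) \<Rightarrow> (complex poly \<Rightarrow> complex) \<Rightarrow> bool" where
  "intertwined L L' \<longleftrightarrow> (\<exists>V N. intertwines L L' V \<and> preserves_degree V \<and>
     intertwines L' L N \<and> preserves_degree N)"

lemma intertwined_refl: "intertwined L L"
proof -
  have "intertwines L L (\<lambda>p. p)" "preserves_degree (\<lambda>p. p)"
    by (auto simp: intertwines_def preserves_degree_def scalar_diff_ops_id intro: exI[of _ 1])
  then show ?thesis unfolding intertwined_def by blast
qed

lemma intertwined_sym: "intertwined L L' \<Longrightarrow> intertwined L' L"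
  unfolding intertwined_def by blast

lemma intertwines_comp:
  assumes "intertwines L L' V" "intertwines L' L'' W"
  shows "intertwines L L'' (\<lambda>p. W (V p))"
  unfolding intertwines_def
proof (intro conjI allI)
  show "(\<lambda>p. W (V p)) \<in> scalar_diff_ops"
    using assms by (auto simp: intertwines_def intro: scalar_diff_ops_comp)
  fix n
  obtain a b where "V (orth_poly L n) = smult a (orth_poly L' n)"
    "W (orth_poly L' n) = smult b (orth_poly L'' n)"
    using assms unfolding intertwines_def by meson
  moreover have "W \<in> scalar_diff_ops" using assms by (simp add: intertwines_def)
  ultimately show "\<exists>a. W (V (orth_poly L n)) = smult a (orth_poly L'' n)"
    by (auto simp: scalar_diff_op_linear)
qed

lemma intertwined_trans:
  assumes "intertwined L L'" "intertwined L' L''"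
  shows "intertwined L L''"
proof -
  obtain V N where 1: "intertwines L L' V" "preserves_degree V" "intertwines L' L N" "preserves_degree N"
    using assms(1) by (auto simp: intertwined_def)
  obtain V' N' where 2: "intertwines L' L'' V'" "preserves_degree V'" "intertwines L'' L' N'" "preserves_degree N'"
    using assms(2) by (auto simp: intertwined_def)
  have "intertwines L L'' (\<lambda>p. V' (V p))" "intertwines L'' L (\<lambda>p. N (N' p))"
    using 1 2 by (auto intro: intertwines_comp)
  moreover have "preserves_degree (\<lambda>p. V' (V p))" "preserves_degree (\<lambda>p. N (N' p))"
    using 1 2 by (auto simp: preserves_degree_def)
  ultimately show ?thesis unfolding intertwined_def by blast
qed

text \<open>The operator multiplies the coefficient of \<open>x\<^sup>n\<close>, for \<open>n\<close> the degree, by \<open>n g\<^sub>1 + h\<close>.\<close>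

lemma first_order_preserves_degree:
  assumes "\<And>n. of_nat n * g\<^sub>1 + h \<noteq> 0"
  shows "preserves_degree (\<lambda>p. pderiv p * [:g\<^sub>0, g\<^sub>1:] + p * [:h:])"
proof -
  let ?V = "\<lambda>p. pderiv p * [:g\<^sub>0, g\<^sub>1:] + p * [:h:]"
  have c: "coeff (?V p) k = (of_nat k * g\<^sub>1 + h) * coeff p k + g\<^sub>0 * of_nat (k + 1) * coeff p (k + 1)" for p k
    by (cases k) (simp_all add: coeff_pderiv algebra_simps)
  have deg: "degree (?V p) = degree p" for p
  proof (rule antisym)
    show "degree (?V p) \<le> degree p" by (rule degree_le) (simp only: c, simp add: coeff_eq_0)
    show "degree p \<le> degree (?V p)"
    proof (cases "p = 0")
      case False
      have "coeff (?V p) (degree p) \<noteq> 0" unfolding c using assms False by (simp add: coeff_eq_0)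
      then show ?thesis by (rule le_degree)
    qed simp
  qed
  moreover have "?V p = 0 \<longleftrightarrow> p = 0" for p
  proof
    assume V0: "?V p = 0"
    have "coeff (?V p) (degree p) = (of_nat (degree p) * g\<^sub>1 + h) * lead_coeff p"
      unfolding c by (simp add: coeff_eq_0)
    then have "(of_nat (degree p) * g\<^sub>1 + h) * lead_coeff p = 0" unfolding V0 by simp
    then show "p = 0" using assms[of "degree p"] by simp
  qed simp
  ultimately show ?thesis unfolding preserves_degree_def by blast
qed

lemma adjoint_first_order_intertwined:
  assumes L: "moment_functional L" and L': "moment_functional L'"
    and V: "\<And>n. of_nat n * v\<^sub>1 + v \<noteq> 0" and U: "\<And>n. of_nat n * u\<^sub>1 + u \<noteq> 0"
    and adj: "\<And>p q. L' ((pderiv p * [:v\<^sub>0, v\<^sub>1:] + p * [:v:]) * q)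
      = L (p * (pderiv q * [:u\<^sub>0, u\<^sub>1:] + q * [:u:]))"
  shows "intertwined L L'"
proof -
  define V where "V = (\<lambda>p. pderiv p * [:v\<^sub>0, v\<^sub>1:] + p * [:v:])"
  define U where "U = (\<lambda>p. pderiv p * [:u\<^sub>0, u\<^sub>1:] + p * [:u:])"
  have pV: "preserves_degree V" and pU: "preserves_degree U"
    unfolding V_def U_def by (rule first_order_preserves_degree[OF V] first_order_preserves_degree[OF U])+
  then have deg: "degree (V p) \<le> degree p" "degree (U p) \<le> degree p" for p
    by (simp_all add: preserves_degree_def)
  have "V \<in> scalar_diff_ops" "U \<in> scalar_diff_ops"
    unfolding V_def U_def by (rule scalar_diff_ops_first_order)+
  moreover have adj': "L' (V p * q) = L (p * U q)" for p q using adj by (simp add: V_def U_def)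
  have "L (U p * q) = L' (p * V q)" for p q
    using adj'[of q p] by (simp add: mult.commute)
  note adjoint_maps_orth_poly[OF L L' adj' deg] adjoint_maps_orth_poly[OF L' L this deg(2,1)]
  ultimately have "intertwines L L' V" "intertwines L' L U" unfolding intertwines_def by blast+
  then show ?thesis using pV pU unfolding intertwined_def by blast
qed

text \<open>
  \<open>V p = p - p'\<close> leads from \<open>L\<close> to the functional \<open>L'\<close> of the weight multiplied by \<open>x\<close>, and its adjoint is
  \<open>U q = x q' + (\<alpha> + 1) q\<close>: the difference of \<open>L (p * U q)\<close> and \<open>L' (V p * q)\<close> is the Pearson equation
  for \<open>p q\<close>.
\<close>

lemma laguerre_step:
  assumes L: "pearson_functional L [:0, 1:] [:of_real (\<alpha> + 1), -1:]" and "\<alpha> > -1"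
    and L': "moment_functional L'" "\<And>p. L' p = L ([:0, 1:] * p)"
  shows "intertwined L L'"
proof -
  interpret pearson_functional L "[:0, 1:]" "[:of_real (\<alpha> + 1), -1:]" by fact
  have nz: "of_nat n + of_real (\<alpha> + 1) \<noteq> (0 :: complex)" for n
  proof -
    have "of_nat n + of_real (\<alpha> + 1) = complex_of_real (real n + (\<alpha> + 1))" by simp
    also have "\<dots> \<noteq> 0" using \<open>\<alpha> > -1\<close> by (simp only: of_real_eq_0_iff)
    finally show ?thesis .
  qed
  show ?thesis
  proof (rule adjoint_first_order_intertwined[OF moment_functional_axioms L'(1),
        where v\<^sub>0 = "-1" and v\<^sub>1 = 0 and v = 1 and u\<^sub>0 = 0 and u\<^sub>1 = 1 and u = "of_real (\<alpha> + 1)"])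
    fix p q :: "complex poly"
    have "p * (pderiv q * [:0, 1:] + q * [:of_real (\<alpha> + 1):])
      = [:0, 1:] * ((pderiv p * [:-1, 0:] + p * [:1:]) * q)
        + ([:0, 1:] * pderiv (p * q) + [:of_real (\<alpha> + 1), -1:] * (p * q))"
    proof -
      have *: "[:of_real (\<alpha> + 1), -1:] = [:of_real (\<alpha> + 1):] - [:0, 1 :: complex:]"
        "[:-1, 0 :: complex:] = - 1" "[:1 :: complex:] = 1" by (simp_all add: one_pCons)
      show ?thesis unfolding * pderiv_mult by algebra
    qed
    then show "L' ((pderiv p * [:-1, 0:] + p * [:1:]) * q)
        = L (p * (pderiv q * [:0, 1:] + q * [:of_real (\<alpha> + 1):]))"
      using pearson[of "p * q"] unfolding L'(2) by (metis add add.right_neutral)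
  qed (use nz in auto)
qed

text \<open>
  Both weights \<open>(\<alpha>, \<beta> + 1)\<close> and \<open>(\<alpha> + 1, \<beta>)\<close> are linear multiples of the weight \<open>(\<alpha>, \<beta>)\<close> of \<open>L\<^sub>0\<close>.
  The operator \<open>V p = (1 + x) p' + (\<beta> + 1) p\<close> has the adjoint \<open>U q = (x - 1) q' + (\<alpha> + 1) q\<close>, again by
  the Pearson equation of \<open>L\<^sub>0\<close> for \<open>p q\<close>.
\<close>

lemma jacobi_step:
  assumes L\<^sub>0: "pearson_functional L\<^sub>0 [:1, 0, -1:] (jacobi_\<psi> \<alpha> \<beta>)" and gt: "\<alpha> > -1" "\<beta> > -1"
    and L: "moment_functional L" "\<And>p. L p = L\<^sub>0 ([:1, 1:] * p)"
    and L': "moment_functional L'" "\<And>p. L' p = L\<^sub>0 ([:1, -1:] * p)"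
  shows "intertwined L L'"
proof -
  interpret pearson_functional L\<^sub>0 "[:1, 0, -1:]" "jacobi_\<psi> \<alpha> \<beta>" by fact
  have nz: "of_nat n + of_real (\<gamma> + 1) \<noteq> (0 :: complex)" if "\<gamma> > -1" for n and \<gamma> :: real
  proof -
    have "of_nat n + of_real (\<gamma> + 1) = complex_of_real (real n + (\<gamma> + 1))" by simp
    also have "\<dots> \<noteq> 0" using that by (simp only: of_real_eq_0_iff)
    finally show ?thesis .
  qed
  show ?thesis
  proof (rule adjoint_first_order_intertwined[OF L(1) L'(1), where v\<^sub>0 = 1 and v\<^sub>1 = 1
        and v = "of_real (\<beta> + 1)" and u\<^sub>0 = "-1" and u\<^sub>1 = 1 and u = "of_real (\<alpha> + 1)"])
    fix p q :: "complex poly"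
    have "[:1, -1:] * ((pderiv p * [:1, 1:] + p * [:of_real (\<beta> + 1):]) * q)
      = [:1, 1:] * (p * (pderiv q * [:-1, 1:] + q * [:of_real (\<alpha> + 1):]))
        + ([:1, 0, -1:] * pderiv (p * q) + jacobi_\<psi> \<alpha> \<beta> * (p * q))"
    proof -
      define X where "X = [:0, 1 :: complex:]"
      have *: "[:1, -1:] = 1 - X" "[:1, 1:] = 1 + X" "[:-1, 1:] = X - 1"
        "[:1, 0, -1:] = 1 - X * X" by (simp_all add: X_def one_pCons)
      have \<psi>: "jacobi_\<psi> \<alpha> \<beta> = ([:of_real (\<beta> + 1):] - [:of_real (\<alpha> + 1):])
          - ([:of_real (\<alpha> + 1):] + [:of_real (\<beta> + 1):]) * X"
        by (simp add: jacobi_\<psi>_def X_def)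
      show ?thesis unfolding \<psi> * pderiv_mult by algebra
    qed
    then show "L' ((pderiv p * [:1, 1:] + p * [:of_real (\<beta> + 1):]) * q)
        = L (p * (pderiv q * [:-1, 1:] + q * [:of_real (\<alpha> + 1):]))"
      using pearson[of "p * q"] unfolding L'(2) L(2) by (metis add add.right_neutral)
  qed (use nz gt in auto)
qed

section \<open>Moment functionals of weights\<close>

definition weight_functional :: "real set \<Rightarrow> (real \<Rightarrow> real) \<Rightarrow> complex poly \<Rightarrow> complex" where
  "weight_functional S w p = (LINT x:S|lborel. poly p (complex_of_real x) * complex_of_real (w x))"

definition weight_on :: "real set \<Rightarrow> (real \<Rightarrow> real) \<Rightarrow> bool" where
  "weight_on S w \<longleftrightarrow> open S \<and> S \<noteq> {} \<and> (\<forall>x\<in>S. w x > 0) \<and>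
    (\<forall>p. set_integrable lborel S (\<lambda>x. poly p (complex_of_real x) * complex_of_real (w x)))"

lemma weight_on_integrable:
  "weight_on S w \<Longrightarrow> set_integrable lborel S (\<lambda>x. poly p (complex_of_real x) * complex_of_real (w x))"
  by (simp add: weight_on_def)

lemma weight_functional_cong:
  assumes "\<And>x. x \<in> S \<Longrightarrow> poly p (of_real x) * of_real (w x) = poly q (of_real x) * complex_of_real (w' x)"
    and "S \<in> sets lborel"
  shows "weight_functional S w p = weight_functional S w' q"
  unfolding weight_functional_def using assms by (intro set_lebesgue_integral_cong) auto

lemma cnj_set_integral:
  fixes f :: "_ \<Rightarrow> complex"
  shows "cnj (LINT x:S|M. f x) = (LINT x:S|M. cnj (f x))"
  unfolding set_lebesgue_integral_def
  by (simp flip: Bochner_Integration.integral_cnj)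

lemma poly_map_poly_cnj: "poly (map_poly cnj p) (of_real x) = cnj (poly p (of_real x))"
  using poly_cnj[of p "of_real x"] by simp

lemma weight_moment_functional:
  assumes "weight_on S w"
  shows "moment_functional (weight_functional S w)"
proof
  note int = weight_on_integrable[OF assms]
  have "open S" "S \<noteq> {}" and pos: "\<And>x. x \<in> S \<Longrightarrow> w x > 0" using assms by (auto simp: weight_on_def)
  fix p q :: "complex poly" and c :: complex
  show "weight_functional S w (p + q) = weight_functional S w p + weight_functional S w q"
    by (simp add: weight_functional_def distrib_right set_integral_add int)
  show "weight_functional S w (smult c p) = c * weight_functional S w p"
    by (simp add: weight_functional_def mult.assoc)
  show "weight_functional S w (p * map_poly cnj q) = cnj (weight_functional S w (q * map_poly cnj p))"
    unfolding weight_functional_def by (subst cnj_set_integral) (simp add: poly_map_poly_cnj mult_ac)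
  show "weight_functional S w (p * map_poly cnj p) \<noteq> 0" if "p \<noteq> 0"
  proof
    assume 0: "weight_functional S w (p * map_poly cnj p) = 0"
    let ?f = "\<lambda>x. indicator S x * ((cmod (poly p (of_real x)))\<^sup>2 * w x)"
    have eq: "indicator S x *\<^sub>R (poly (p * map_poly cnj p) (of_real x) * of_real (w x)) = complex_of_real (?f x)" for x
      by (simp add: poly_map_poly_cnj flip: complex_norm_square split: split_indicator)
    have "integrable lborel (\<lambda>x. complex_of_real (?f x))"
      using int[of "p * map_poly cnj p"] unfolding set_integrable_def eq .
    then have i: "integrable lborel ?f" by (simp only: complex_of_real_integrable_eq)
    have "complex_of_real (integral\<^sup>L lborel ?f) = 0"
      using 0 unfolding weight_functional_def set_lebesgue_integral_def eq by (simp only: integral_complex_of_real)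
    then have "integral\<^sup>L lborel ?f = 0" by simp
    moreover have "?f x \<ge> 0" for x using pos[of x] by (auto split: split_indicator)
    ultimately have "AE x in lborel. ?f x = 0"
      using integral_nonneg_eq_0_iff_AE[OF i] by simp
    then have ae: "AE x in lborel. x \<notin> S - {x. poly p (of_real x) = 0}"
    proof eventually_elim
      case (elim x)
      then show ?case using pos[of x] by (auto split: split_indicator_asm)
    qed
    have "finite {x. poly p (of_real x) = (0 :: complex)}"
    proof (rule finite_imageD[where f = complex_of_real])
      show "finite (complex_of_real ` {x. poly p (of_real x) = 0})"
        by (rule finite_subset[OF _ poly_roots_finite[OF that]]) auto
    qed (auto simp: inj_on_def)
    then have op: "open (S - {x. poly p (of_real x) = (0 :: complex)})" and ne: "S - {x. poly p (of_real x) = (0 :: complex)} \<noteq> {}"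
      using \<open>open S\<close> \<open>S \<noteq> {}\<close> finite_imp_not_open[of S] finite_subset[of S]
      by (auto intro!: open_Diff finite_imp_closed)
    then have "S - {x. poly p (of_real x) = (0 :: complex)} \<in> null_sets lborel"
      using ae by (subst AE_iff_null_sets) (auto intro: borel_open)
    then have "negligible (S - {x. poly p (of_real x) = (0 :: complex)})"
      by (simp add: negligible_iff_null_sets null_sets_completionI)
    with open_not_negligible[OF op ne] show False ..
  qed
qed

text \<open>
  The integrand is the derivative of \<open>\<phi> p w\<close>, which vanishes at both ends of the interval.
\<close>

lemma weight_pearson_functional:
  fixes a b :: ereal
  assumes w: "weight_on (einterval a b) w" and "a < b"
    and deg: "degree \<phi> \<le> 2" "degree \<psi> \<le> 1"
    and deriv: "\<And>x. x \<in> einterval a b \<Longrightarrow> (w has_real_derivative w' x) (at x)"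
    and ode: "\<And>x. x \<in> einterval a b \<Longrightarrow> poly \<phi> (of_real x) * complex_of_real (w' x)
      + poly (pderiv \<phi>) (of_real x) * of_real (w x) = poly \<psi> (of_real x) * of_real (w x)"
    and lim: "\<And>p. (((\<lambda>x. poly (\<phi> * p) (complex_of_real x) * of_real (w x)) \<circ> real_of_ereal) \<longlongrightarrow> 0) (at_right a)"
      "\<And>p. (((\<lambda>x. poly (\<phi> * p) (complex_of_real x) * of_real (w x)) \<circ> real_of_ereal) \<longlongrightarrow> 0) (at_left b)"
  shows "pearson_functional (weight_functional (einterval a b) w) \<phi> \<psi>"
proof (rule pearson_functional.intro[OF weight_moment_functional[OF w]], unfold_locales)
  fix p
  let ?F = "\<lambda>x. poly (\<phi> * p) (complex_of_real x) * complex_of_real (w x)"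
  let ?f = "\<lambda>x. poly (\<phi> * pderiv p + \<psi> * p) (complex_of_real x) * complex_of_real (w x)"
  have "(LBINT x=a..b. ?f x) = 0 - 0"
  proof (rule interval_integral_FTC_integrable[where F = ?F])
    fix x assume x: "a < ereal x" "ereal x < b"
    then have x': "x \<in> einterval a b" by (simp add: einterval_iff)
    have "(poly (\<phi> * p) has_field_derivative poly (pderiv (\<phi> * p)) (of_real x)) (at (complex_of_real x))"
      by (rule poly_DERIV)
    then have "((\<lambda>x. poly (\<phi> * p) (complex_of_real x)) has_vector_derivative
        poly (pderiv (\<phi> * p)) (of_real x)) (at x)"
      by (rule has_vector_derivative_real_field)
    moreover have "((\<lambda>x. complex_of_real (w x)) has_vector_derivative of_real (w' x)) (at x)"
      using deriv[OF x'] by (intro has_vector_derivative_of_real) (simp add: has_real_derivative_iff_has_vector_derivative)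
    ultimately have "(?F has_vector_derivative poly (\<phi> * p) (of_real x) * of_real (w' x)
        + poly (pderiv (\<phi> * p)) (of_real x) * of_real (w x)) (at x)"
      by (rule has_vector_derivative_mult)
    also have "poly (\<phi> * p) (of_real x) * of_real (w' x) + poly (pderiv (\<phi> * p)) (of_real x) * of_real (w x)
      = ?f x"
    proof -
      have "poly (\<phi> * p) (of_real x) * of_real (w' x) + poly (pderiv (\<phi> * p)) (of_real x) * of_real (w x)
        = poly p (of_real x) * (poly \<phi> (of_real x) * complex_of_real (w' x)
          + poly (pderiv \<phi>) (of_real x) * of_real (w x)) + poly \<phi> (of_real x) * poly (pderiv p) (of_real x) * of_real (w x)"
        by (simp add: pderiv_mult algebra_simps)
      then show ?thesis unfolding ode[OF x'] by (simp add: algebra_simps)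
    qed
    finally show "(?F has_vector_derivative ?f x) (at x)" .
    have "isCont w x" using deriv[OF x'] by (rule DERIV_isCont)
    then show "isCont ?f x" by (intro continuous_intros) auto
  next
    show "set_integrable lborel (einterval a b) ?f" by (rule weight_on_integrable[OF w])
  qed (fact \<open>a < b\<close> lim)+
  then show "weight_functional (einterval a b) w (\<phi> * pderiv p + \<psi> * p) = 0"
    using \<open>a < b\<close> by (simp add: weight_functional_def interval_lebesgue_integral_le_eq)
qed (use deg in auto)

text \<open>
  The centre \<open>c\<close> is free because for shifted Hermite weights the moments about \<open>b\<close> are the known
  moments of a normal distribution.
\<close>

lemma set_integrable_poly_weight:
  fixes c :: real
  assumes "\<And>k. set_integrable lborel S (\<lambda>x. (x - c) ^ k * w x)"
  shows "set_integrable lborel S (\<lambda>x. poly p (complex_of_real x) * complex_of_real (w x))"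
proof -
  let ?q = "p \<circ>\<^sub>p [:of_real c, 1:]"
  have "set_integrable lborel S (\<lambda>x. complex_of_real ((x - c) ^ k * w x))" for k
    using assms[of k] unfolding set_integrable_def
    by (simp add: scaleR_conv_of_real flip: of_real_mult)
  then have "set_integrable lborel S (\<lambda>x. \<Sum>k\<le>degree ?q. coeff ?q k * complex_of_real ((x - c) ^ k * w x))"
    unfolding set_integrable_def scaleR_sum_right
    by (intro Bochner_Integration.integrable_sum)
      (simp only: mult_scaleR_right[symmetric], rule integrable_mult_right)
  also have "(\<lambda>x. \<Sum>k\<le>degree ?q. coeff ?q k * complex_of_real ((x - c) ^ k * w x))
    = (\<lambda>x. poly p (complex_of_real x) * complex_of_real (w x))"
  proof
    fix x
    have "poly p (complex_of_real x) = poly ?q (of_real (x - c))" by (simp add: poly_pcompose)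
    then show "(\<Sum>k\<le>degree ?q. coeff ?q k * complex_of_real ((x - c) ^ k * w x))
      = poly p (complex_of_real x) * complex_of_real (w x)"
      by (simp add: poly_altdef[of ?q] sum_distrib_right mult.assoc)
  qed
  finally show ?thesis .
qed

lemma tendsto_poly_mult_0:
  fixes w :: "real \<Rightarrow> real"
  assumes "\<And>k. ((\<lambda>x. x ^ k * w x) \<longlongrightarrow> 0) F"
  shows "((\<lambda>x. poly p (complex_of_real x) * complex_of_real (w x)) \<longlongrightarrow> 0) F"
proof -
  have "((\<lambda>x. \<Sum>k\<le>degree p. coeff p k * complex_of_real (x ^ k * w x)) \<longlongrightarrow>
      (\<Sum>k\<le>degree p. coeff p k * of_real 0)) F"
    by (intro tendsto_intros assms)
  then show ?thesis by (simp add: poly_altdef sum_distrib_right mult.assoc)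
qed

subsection \<open>Shifted Hermite weights\<close>

definition hermite_weight :: "real \<Rightarrow> real \<Rightarrow> real" where
  "hermite_weight b x = exp (- x\<^sup>2 + 2 * b * x)"

lemma weight_on_hermite: "weight_on UNIV (hermite_weight b)"
  unfolding weight_on_def
proof (intro conjI allI ballI)
  fix p
  show "set_integrable lborel UNIV (\<lambda>x. poly p (complex_of_real x) * complex_of_real (hermite_weight b x))"
  proof (rule set_integrable_poly_weight[where c = b])
    fix k
    have "integrable lborel (\<lambda>x. (sqrt pi * exp (b\<^sup>2)) * (normal_density b (1 / sqrt 2) x * (x - b) ^ k))"
      by (intro integrable_mult_right integrable_normal_moment) simp
    also have "(\<lambda>x. (sqrt pi * exp (b\<^sup>2)) * (normal_density b (1 / sqrt 2) x * (x - b) ^ k))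
      = (\<lambda>x. (x - b) ^ k * hermite_weight b x)"
    proof
      fix x
      have "exp (b\<^sup>2) * exp (- (x - b)\<^sup>2) = hermite_weight b x"
        unfolding hermite_weight_def by (simp add: power2_eq_square algebra_simps flip: exp_add)
      moreover have "sqrt pi * normal_density b (1 / sqrt 2) x = exp (- (x - b)\<^sup>2)"
        by (simp add: normal_density_def power_divide real_sqrt_mult)
      ultimately have "hermite_weight b x = exp (b\<^sup>2) * (sqrt pi * normal_density b (1 / sqrt 2) x)"
        by simp
      then show "(sqrt pi * exp (b\<^sup>2)) * (normal_density b (1 / sqrt 2) x * (x - b) ^ k)
        = (x - b) ^ k * hermite_weight b x"
        by (simp only: mult_ac)
    qed
    finally show "set_integrable lborel UNIV (\<lambda>x. (x - b) ^ k * hermite_weight b x)"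
      by (simp add: set_integrable_def)
  qed
qed (auto simp: hermite_weight_def)

lemma pearson_hermite:
  "pearson_functional (weight_functional UNIV (hermite_weight b)) 1 [:of_real (2 * b), -2:]"
proof -
  have top: "((\<lambda>x. x ^ k * hermite_weight b x) \<longlongrightarrow> 0) at_top" for k b
  proof -
    have "((\<lambda>x. exp (x - x\<^sup>2 + 2 * b * x)) \<longlongrightarrow> 0) at_top" by real_asymp
    from tendsto_mult[OF tendsto_power_div_exp_0[of k] this] show ?thesis
      by (simp add: hermite_weight_def exp_add exp_diff field_simps exp_minus)
  qed
  have bot: "((\<lambda>x. x ^ k * hermite_weight b x) \<longlongrightarrow> 0) at_bot" for k
  proof -
    have "((\<lambda>x. (-1) ^ k * (x ^ k * hermite_weight (- b) x)) \<longlongrightarrow> (-1) ^ k * 0) at_top"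
      by (intro tendsto_intros top)
    then show ?thesis
      by (subst filterlim_at_bot_mirror)
        (simp add: hermite_weight_def mult.assoc[symmetric] flip: power_mult_distrib)
  qed
  have "pearson_functional (weight_functional (einterval (-\<infinity>) \<infinity>) (hermite_weight b)) 1 [:of_real (2 * b), -2:]"
  proof (rule weight_pearson_functional[where w' = "\<lambda>x. hermite_weight b x * (2 * b - 2 * x)"])
    show "(hermite_weight b has_real_derivative hermite_weight b x * (2 * b - 2 * x)) (at x)" for x
      unfolding hermite_weight_def[abs_def] by (auto intro!: derivative_eq_intros simp: algebra_simps)
  qed (use weight_on_hermite[of b] tendsto_poly_mult_0[OF top] tendsto_poly_mult_0[OF bot]
      in \<open>auto simp: ereal_tendsto_simps1 algebra_simps pderiv_1\<close>)
  then show ?thesis by simp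
qed

subsection \<open>Laguerre weights\<close>

definition laguerre_weight :: "real \<Rightarrow> real \<Rightarrow> real" where
  "laguerre_weight \<alpha> x = exp (- x) * x powr \<alpha>"

lemma weight_on_laguerre:
  assumes "\<alpha> > -1"
  shows "weight_on {0<..} (laguerre_weight \<alpha>)"
  unfolding weight_on_def
proof (intro conjI allI ballI)
  fix p
  show "set_integrable lborel {0<..} (\<lambda>x. poly p (complex_of_real x) * complex_of_real (laguerre_weight \<alpha> x))"
  proof (rule set_integrable_poly_weight[where c = 0])
    fix k
    let ?g = "\<lambda>t. t powr (\<alpha> + real k + 1 - 1) / exp t"
    have "?g integrable_on {0..}"
      by (rule has_integral_integrable[OF Gamma_integral_real]) (use assms in simp)
    then have "?g absolutely_integrable_on {0..}"
      by (rule nonnegative_absolutely_integrable_1) auto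
    then have "?g absolutely_integrable_on {0<..}"
      by (rule set_integrable_subset) auto
    then have "set_integrable lborel {0<..} ?g"
      unfolding set_integrable_def by (subst (asm) integrable_completion) auto
    then show "set_integrable lborel {0<..} (\<lambda>x. (x - 0) ^ k * laguerre_weight \<alpha> x)"
      by (rule set_integrable_cong[THEN iffD1, rotated -1])
        (auto simp: laguerre_weight_def powr_add powr_realpow exp_minus field_simps)
  qed
qed (auto simp: laguerre_weight_def)

lemma pearson_laguerre:
  assumes "\<alpha> > -1"
  shows "pearson_functional (weight_functional {0<..} (laguerre_weight \<alpha>)) [:0, 1:] [:of_real (\<alpha> + 1), -1:]"
proof -
  have top: "((\<lambda>x. x ^ k * laguerre_weight \<alpha> x) \<longlongrightarrow> 0) at_top" for k
  proof -
    have "((\<lambda>x. x powr (\<alpha> + real k) * exp (- x)) \<longlongrightarrow> 0) at_top" by real_asymp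
    then show ?thesis
      by (rule Lim_transform_eventually)
        (auto simp: eventually_at_top_dense laguerre_weight_def powr_add powr_realpow mult_ac intro!: exI[of _ 0])
  qed
  have zero: "((\<lambda>x. x ^ k * (x * laguerre_weight \<alpha> x)) \<longlongrightarrow> 0) (at_right 0)" for k
  proof -
    have "((\<lambda>x. x powr (\<alpha> + 1)) \<longlongrightarrow> 0 powr (\<alpha> + 1)) (at_right 0)"
      using assms by (intro tendsto_powr' tendsto_intros) (auto simp: eventually_at_right_less intro: eventually_at_rightI[of 0 1])
    then have "((\<lambda>x. x ^ k * (exp (- x) * x powr (\<alpha> + 1))) \<longlongrightarrow> 0 ^ k * (exp (- 0) * 0)) (at_right 0)"
      by (intro tendsto_intros) auto
    then have "((\<lambda>x. x ^ k * (exp (- x) * x powr (\<alpha> + 1))) \<longlongrightarrow> 0) (at_right 0)"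
      by (rule tendsto_eq_rhs) simp
    then show ?thesis
      by (rule Lim_transform_eventually)
        (auto simp: laguerre_weight_def powr_add mult_ac intro!: eventually_at_rightI[of 0 1])
  qed
  have "pearson_functional (weight_functional (einterval (ereal 0) \<infinity>) (laguerre_weight \<alpha>)) [:0, 1:] [:of_real (\<alpha> + 1), -1:]"
  proof (rule weight_pearson_functional[where w' = "\<lambda>x. (\<alpha> / x - 1) * laguerre_weight \<alpha> x"])
    fix x assume "x \<in> einterval (ereal 0) \<infinity>"
    then have x: "x > 0" by simp
    show "(laguerre_weight \<alpha> has_real_derivative (\<alpha> / x - 1) * laguerre_weight \<alpha> x) (at x)"
      unfolding laguerre_weight_def[abs_def] using x
      by (auto intro!: derivative_eq_intros simp: powr_diff field_simps)
    show "poly [:0, 1:] (of_real x) * complex_of_real ((\<alpha> / x - 1) * laguerre_weight \<alpha> x)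
      + poly (pderiv [:0, 1:]) (of_real x) * of_real (laguerre_weight \<alpha> x)
      = poly [:of_real (\<alpha> + 1), -1:] (of_real x) * of_real (laguerre_weight \<alpha> x)"
      using x by (simp add: pderiv_pCons field_simps)
  next
    fix p
    show "(((\<lambda>x. poly ([:0, 1:] * p) (complex_of_real x) * complex_of_real (laguerre_weight \<alpha> x)) \<circ> real_of_ereal) \<longlongrightarrow> 0) (at_right (ereal 0))"
      using tendsto_poly_mult_0[OF zero, of p] by (simp add: ereal_tendsto_simps1 mult_ac)
    show "(((\<lambda>x. poly ([:0, 1:] * p) (complex_of_real x) * complex_of_real (laguerre_weight \<alpha> x)) \<circ> real_of_ereal) \<longlongrightarrow> 0) (at_left \<infinity>)"
      unfolding ereal_tendsto_simps1 by (rule tendsto_poly_mult_0[OF top])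
  qed (use weight_on_laguerre[OF assms] in auto)
  then show ?thesis by simp
qed

subsection \<open>Jacobi weights\<close>

definition jacobi_weight :: "real \<Rightarrow> real \<Rightarrow> real \<Rightarrow> real" where
  "jacobi_weight \<alpha> \<beta> x = (1 - x) powr \<alpha> * (1 + x) powr \<beta>"

lemma weight_on_jacobi:
  assumes "\<alpha> > -1" "\<beta> > -1"
  shows "weight_on {-1<..<1} (jacobi_weight \<alpha> \<beta>)"
  unfolding weight_on_def
proof (intro conjI allI ballI)
  fix p
  have "set_integrable lborel {0..1} (\<lambda>t. t powr (\<beta> + 1 - 1) * (1 - t) powr (\<alpha> + 1 - 1))"
    by (rule integrable_Beta) (use assms in auto)
  then have "set_integrable lborel {0<..<1} (\<lambda>t. t powr \<beta> * (1 - t) powr \<alpha>)"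
    by (rule set_integrable_subset[THEN set_integrable_cong[THEN iffD1, rotated -1]]) auto
  then have "integrable lborel (\<lambda>x. indicator {0<..<1} (1/2 + 1/2 * x) *\<^sub>R
      ((1/2 + 1/2 * x) powr \<beta> * (1 - (1/2 + 1/2 * x)) powr \<alpha>) :: real)"
    unfolding set_integrable_def by (rule lborel_integrable_real_affine) simp
  then have "integrable lborel (\<lambda>x. 2 powr (\<alpha> + \<beta>) * (indicator {0<..<1} (1/2 + 1/2 * x) *\<^sub>R
      ((1/2 + 1/2 * x) powr \<beta> * (1 - (1/2 + 1/2 * x)) powr \<alpha>)) :: real)"
    by (rule integrable_mult_right)
  also have "(\<lambda>x. 2 powr (\<alpha> + \<beta>) * (indicator {0<..<1} (1/2 + 1/2 * x) *\<^sub>R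
      ((1/2 + 1/2 * x) powr \<beta> * (1 - (1/2 + 1/2 * x)) powr \<alpha>)) :: real)
    = (\<lambda>x. indicator {-1<..<1} x *\<^sub>R jacobi_weight \<alpha> \<beta> x)"
  proof
    fix x :: real
    have "1/2 + 1/2 * x = (1 + x) / 2" "1 - (1/2 + 1/2 * x) = (1 - x) / 2" by (simp_all add: field_simps)
    then show "2 powr (\<alpha> + \<beta>) * (indicator {0<..<1} (1/2 + 1/2 * x) *\<^sub>R
      ((1/2 + 1/2 * x) powr \<beta> * (1 - (1/2 + 1/2 * x)) powr \<alpha>))
      = indicator {-1<..<1} x *\<^sub>R jacobi_weight \<alpha> \<beta> x"
      by (simp only:) (auto simp: jacobi_weight_def powr_divide powr_add split: split_indicator)
  qed
  finally have w: "integrable lborel (\<lambda>x. indicator {-1<..<1} x *\<^sub>R jacobi_weight \<alpha> \<beta> x)" .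
  show "set_integrable lborel {-1<..<1} (\<lambda>x. poly p (complex_of_real x) * complex_of_real (jacobi_weight \<alpha> \<beta> x))"
  proof (rule set_integrable_poly_weight[where c = 0], unfold set_integrable_def, rule Bochner_Integration.integrable_bound[OF w])
    fix k
    show "(\<lambda>x. indicat_real {-1<..<1} x *\<^sub>R ((x - 0) ^ k * jacobi_weight \<alpha> \<beta> x)) \<in> borel_measurable lborel"
      unfolding jacobi_weight_def by measurable
    show "AE x in lborel. norm (indicat_real {-1<..<1} x *\<^sub>R ((x - 0) ^ k * jacobi_weight \<alpha> \<beta> x))
        \<le> norm (indicat_real {-1<..<1} x *\<^sub>R jacobi_weight \<alpha> \<beta> x)"
      by (rule AE_I2) (auto simp: abs_mult power_abs intro!: mult_left_le_one_le power_le_one split: split_indicator)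
  qed
qed (auto simp: jacobi_weight_def)

lemma pearson_jacobi:
  assumes "\<alpha> > -1" "\<beta> > -1"
  shows "pearson_functional (weight_functional {-1<..<1} (jacobi_weight \<alpha> \<beta>)) [:1, 0, -1:] (jacobi_\<psi> \<alpha> \<beta>)"
proof -
  have ev: "eventually (\<lambda>x. x \<in> {-1<..<1}) (at_right (-1 :: real))" "eventually (\<lambda>x. x \<in> {-1<..<1}) (at_left (1 :: real))"
    by (auto intro!: eventually_at_rightI[of _ 1] eventually_at_leftI[of "-1"])
  have eq: "x ^ k * ((1 - x) powr (\<alpha> + 1) * (1 + x) powr (\<beta> + 1)) = x ^ k * ((1 - x\<^sup>2) * jacobi_weight \<alpha> \<beta> x)"
    if "x \<in> {-1<..<1}" for x k
    using that by (auto simp: jacobi_weight_def powr_add power2_eq_square algebra_simps)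
  have left: "((\<lambda>x. x ^ k * ((1 - x\<^sup>2) * jacobi_weight \<alpha> \<beta> x)) \<longlongrightarrow> 0) (at_right (-1))" for k
  proof -
    have "((\<lambda>x. x ^ k * ((1 - x) powr (\<alpha> + 1) * (1 + x) powr (\<beta> + 1))) \<longlongrightarrow>
        (-1) ^ k * ((1 - -1) powr (\<alpha> + 1) * (1 + -1) powr (\<beta> + 1))) (at_right (-1))"
      using assms by (intro tendsto_mult tendsto_powr' tendsto_intros) (auto intro: eventually_mono[OF ev(1)])
    then have "((\<lambda>x. x ^ k * ((1 - x) powr (\<alpha> + 1) * (1 + x) powr (\<beta> + 1))) \<longlongrightarrow> 0) (at_right (-1))"
      by (rule tendsto_eq_rhs) simp
    then show ?thesis
      by (rule Lim_transform_eventually) (rule eventually_mono[OF ev(1)], rule eq)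
  qed
  have right: "((\<lambda>x. x ^ k * ((1 - x\<^sup>2) * jacobi_weight \<alpha> \<beta> x)) \<longlongrightarrow> 0) (at_left 1)" for k
  proof -
    have "((\<lambda>x. x ^ k * ((1 - x) powr (\<alpha> + 1) * (1 + x) powr (\<beta> + 1))) \<longlongrightarrow>
        1 ^ k * ((1 - 1) powr (\<alpha> + 1) * (1 + 1) powr (\<beta> + 1))) (at_left 1)"
      using assms by (intro tendsto_mult tendsto_powr' tendsto_intros) (auto intro: eventually_mono[OF ev(2)])
    then have "((\<lambda>x. x ^ k * ((1 - x) powr (\<alpha> + 1) * (1 + x) powr (\<beta> + 1))) \<longlongrightarrow> 0) (at_left 1)"
      by (rule tendsto_eq_rhs) simp
    then show ?thesis
      by (rule Lim_transform_eventually) (rule eventually_mono[OF ev(2)], rule eq)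
  qed
  have F: "poly ([:1, 0, -1:] * p) (complex_of_real x) * complex_of_real (jacobi_weight \<alpha> \<beta> x)
      = poly p (complex_of_real x) * complex_of_real ((1 - x\<^sup>2) * jacobi_weight \<alpha> \<beta> x)" for p x
    by (simp add: power2_eq_square algebra_simps)
  have "pearson_functional (weight_functional (einterval (ereal (-1)) (ereal 1)) (jacobi_weight \<alpha> \<beta>)) [:1, 0, -1:] (jacobi_\<psi> \<alpha> \<beta>)"
  proof (rule weight_pearson_functional[where w' = "\<lambda>x. (\<beta> / (1 + x) - \<alpha> / (1 - x)) * jacobi_weight \<alpha> \<beta> x"])
    fix x assume "x \<in> einterval (ereal (-1)) (ereal 1)"
    then have x: "1 - x > 0" "1 + x > 0" by simp_all
    show "(jacobi_weight \<alpha> \<beta> has_real_derivative (\<beta> / (1 + x) - \<alpha> / (1 - x)) * jacobi_weight \<alpha> \<beta> x) (at x)"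
      unfolding jacobi_weight_def[abs_def] using x
      by (auto intro!: derivative_eq_intros simp: powr_diff field_simps)
    have "1 - x\<^sup>2 = (1 - x) * (1 + x)" by (simp add: power2_eq_square algebra_simps)
    then have "(1 - x\<^sup>2) * (\<beta> / (1 + x)) = (1 - x) * \<beta>" "(1 - x\<^sup>2) * (\<alpha> / (1 - x)) = (1 + x) * \<alpha>"
      using x by simp_all
    then have "(1 - x\<^sup>2) * (\<beta> / (1 + x) - \<alpha> / (1 - x)) - 2 * x = \<beta> - \<alpha> - (\<alpha> + \<beta> + 2) * x"
      by (simp only: right_diff_distrib) (simp add: algebra_simps)
    then have "(1 - x\<^sup>2) * ((\<beta> / (1 + x) - \<alpha> / (1 - x)) * jacobi_weight \<alpha> \<beta> x) + (- 2 * x) * jacobi_weight \<alpha> \<beta> x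
      = (\<beta> - \<alpha> - (\<alpha> + \<beta> + 2) * x) * jacobi_weight \<alpha> \<beta> x"
      by algebra
    moreover have "poly [:1, 0, -1:] (of_real x) = complex_of_real (1 - x\<^sup>2)"
      "poly (pderiv [:1, 0, -1:]) (of_real x) = complex_of_real (- 2 * x)"
      "poly (jacobi_\<psi> \<alpha> \<beta>) (of_real x) = complex_of_real (\<beta> - \<alpha> - (\<alpha> + \<beta> + 2) * x)"
      by (simp_all add: pderiv_pCons jacobi_\<psi>_def power2_eq_square algebra_simps)
    ultimately show "poly [:1, 0, -1:] (of_real x) * complex_of_real ((\<beta> / (1 + x) - \<alpha> / (1 - x)) * jacobi_weight \<alpha> \<beta> x)
      + poly (pderiv [:1, 0, -1:]) (of_real x) * of_real (jacobi_weight \<alpha> \<beta> x)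
      = poly (jacobi_\<psi> \<alpha> \<beta>) (of_real x) * of_real (jacobi_weight \<alpha> \<beta> x)"
      by (simp only: of_real_mult[symmetric] of_real_add[symmetric])
  next
    fix p
    show "(((\<lambda>x. poly ([:1, 0, -1:] * p) (complex_of_real x) * complex_of_real (jacobi_weight \<alpha> \<beta> x)) \<circ> real_of_ereal) \<longlongrightarrow> 0) (at_right (ereal (-1)))"
      unfolding ereal_tendsto_simps1 F by (rule tendsto_poly_mult_0[OF left])
    show "(((\<lambda>x. poly ([:1, 0, -1:] * p) (complex_of_real x) * complex_of_real (jacobi_weight \<alpha> \<beta> x)) \<circ> real_of_ereal) \<longlongrightarrow> 0) (at_left (ereal 1))"
      unfolding ereal_tendsto_simps1 F by (rule tendsto_poly_mult_0[OF right])
  qed (use weight_on_jacobi[OF assms] in \<open>auto simp: jacobi_\<psi>_def\<close>)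
  then show ?thesis by simp
qed

section \<open>Orthogonal matrix polynomials of a direct sum\<close>

lemma pmat_degree_le_iff: "pmat_degree P \<le> n \<longleftrightarrow> (\<forall>i j. degree (P $ i $ j) \<le> n)"
proof -
  have "{degree (P $ i $ j) |i j. True} = (\<lambda>(i, j). degree (P $ i $ j)) ` UNIV" by auto
  then show ?thesis unfolding pmat_degree_def by (subst Max_le_iff) auto
qed

lemma pmat_deriv_pow_nth: "(pmat_deriv ^^ k) P $ i $ j = (pderiv ^^ k) (P $ i $ j)"
  by (induction k) (simp_all add: pmat_deriv_def)

lemma diff_op_nth:
  "diff_op r F P $ i $ j = (\<Sum>k\<le>r. \<Sum>l\<in>UNIV. (pderiv ^^ k) (P $ i $ l) * F k $ l $ j)"
  by (simp add: diff_op_def matrix_matrix_mult_def pmat_deriv_pow_nth)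

definition diag_pmat :: "('n::finite \<Rightarrow> complex poly) \<Rightarrow> 'n pmat" where
  "diag_pmat p = (\<chi> i j. if i = j then p i else 0)"

lemma const_pmat_mult_diag_nth: "(const_pmat A ** diag_pmat p) $ i $ j = smult (A $ i $ j) (p j)"
  by (simp add: const_pmat_def diag_pmat_def matrix_matrix_mult_def if_distrib[of "(*) _"] cong: if_cong)

lemma set_integral_matrix_nth:
  fixes f :: "'a \<Rightarrow> complex ^ 'n ^ 'm"
  assumes int: "\<And>i j. set_integrable M S (\<lambda>x. f x $ i $ j)"
  shows "(LINT x:S|M. f x) $ i $ j = (LINT x:S|M. f x $ i $ j)"
proof -
  define g where "g x = indicat_real S x *\<^sub>R f x" for x
  have lin: "bounded_linear (\<lambda>c. axis i (axis j c) :: complex ^ 'n ^ 'm)" for i j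
    by (intro linear_conv_bounded_linear[THEN iffD1] linearI)
      (auto simp: axis_def vec_eq_iff)
  have if_sum: "(\<Sum>b\<in>B. if A then h b else 0) = (if A then sum h B else 0)" for A B and h :: "'n \<Rightarrow> complex"
    by simp
  have g_eq: "g = (\<lambda>x. \<Sum>i\<in>UNIV. \<Sum>j\<in>UNIV. axis i (axis j (g x $ i $ j)))"
    by (auto simp: fun_eq_iff vec_eq_iff axis_def if_distrib[of "\<lambda>v. v $ _"] if_sum cong: if_cong)
  have "integrable M (\<lambda>x. g x $ i $ j)" for i j
    using int[of i j] by (simp add: g_def set_integrable_def)
  then have g: "integrable M g"
    by (subst g_eq) (intro Bochner_Integration.integrable_sum integrable_bounded_linear[OF lin])
  have "bounded_linear (\<lambda>v :: complex ^ 'n ^ 'm. v $ i $ j)"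
    using bounded_linear_compose[OF bounded_linear_vec_nth bounded_linear_vec_nth] .
  from integral_bounded_linear[OF this g] show ?thesis
    by (simp add: set_lebesgue_integral_def g_def[abs_def])
qed

lemma direct_sum_inner_product_nth:
  fixes P Q :: "'n::finite pmat"
  assumes w: "\<And>j. weight_on S (w j)"
  shows "(LINT x:S|lborel. pmat_eval P x ** direct_sum_weight w x ** conj_transpose (pmat_eval Q x)) $ i $ j
    = (\<Sum>k\<in>UNIV. weight_functional S (w k) (P $ i $ k * map_poly cnj (Q $ j $ k)))"
proof -
  let ?f = "\<lambda>i j k x. poly (P $ i $ k * map_poly cnj (Q $ j $ k)) (complex_of_real x) * complex_of_real (w k x)"
  have nth: "(pmat_eval P x ** direct_sum_weight w x ** conj_transpose (pmat_eval Q x)) $ i $ j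
    = (\<Sum>k\<in>UNIV. ?f i j k x)" for x i j
    by (simp add: matrix_matrix_mult_def pmat_eval_def direct_sum_weight_def conj_transpose_def
        transpose_def poly_map_poly_cnj if_distrib[of "(*) _"] mult_ac cong: if_cong)
  have int: "set_integrable lborel S (?f i j k)" for i j k
    using w by (rule weight_on_integrable)
  have int': "set_integrable lborel S (\<lambda>x. \<Sum>k\<in>UNIV. ?f i j k x)" for i j
    using int unfolding set_integrable_def scaleR_sum_right by (intro Bochner_Integration.integrable_sum)
  have "(LINT x:S|lborel. pmat_eval P x ** direct_sum_weight w x ** conj_transpose (pmat_eval Q x)) $ i $ j
    = (LINT x:S|lborel. (\<Sum>k\<in>UNIV. ?f i j k x))"
    by (subst set_integral_matrix_nth) (simp_all only: nth int')
  also have "\<dots> = (\<Sum>k\<in>UNIV. LINT x:S|lborel. ?f i j k x)"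
    using int unfolding set_lebesgue_integral_def set_integrable_def scaleR_sum_right
    by (intro Bochner_Integration.integral_sum)
  finally show ?thesis by (simp only: weight_functional_def)
qed

lemma map_poly_cnj_add: "map_poly cnj (p + q) = map_poly cnj p + map_poly cnj q"
  and map_poly_cnj_smult: "map_poly cnj (smult c p) = smult (cnj c) (map_poly cnj p)"
  by (auto intro!: poly_eqI simp: coeff_map_poly)

lemma map_poly_cnj_sum: "map_poly cnj (sum f A) = (\<Sum>a\<in>A. map_poly cnj (f a))"
  by (induction A rule: infinite_finite_induct) (auto simp: map_poly_cnj_add)

lemma (in moment_functional) sum: "L (sum f A) = (\<Sum>a\<in>A. L (f a))"
  by (induction A rule: infinite_finite_induct) (auto simp: add)

lemma monic_orthogonal_diag:
  fixes w :: "'n::finite \<Rightarrow> real \<Rightarrow> real"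
  assumes w: "\<And>j. weight_on S (w j)"
  shows "monic_orthogonal S (direct_sum_weight w)
    (\<lambda>n. diag_pmat (\<lambda>j. orth_poly (weight_functional S (w j)) n))" (is "monic_orthogonal _ _ ?D")
  unfolding monic_orthogonal_def
proof (intro conjI allI impI)
  note mf = weight_moment_functional[OF w]
  fix n m
  have deg: "degree (?D n $ i $ j) = (if i = j then n else 0)"
    and coeff: "coeff (?D n $ i $ j) n = (if i = j then 1 else 0)" for i j
    using moment_functional.degree_orth_poly[OF mf] moment_functional.coeff_orth_poly[OF mf]
    by (auto simp: diag_pmat_def)
  have "pmat_degree (?D n) \<le> n" by (simp add: pmat_degree_le_iff deg)
  moreover have "n \<le> pmat_degree (?D n)"
    using pmat_degree_le_iff[of "?D n" "pmat_degree (?D n)"] by (auto simp: deg split: if_splits)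
  ultimately show "pmat_degree (?D n) = n" by (rule antisym)
  show "pmat_coeff (?D n) n = mat 1"
    by (simp add: pmat_coeff_def vec_eq_iff mat_def coeff)
  assume "n \<noteq> m"
  have "weight_functional S (w k) (?D n $ i $ k * map_poly cnj (?D m $ j $ k)) = 0" for i j k
    using moment_functional.orth_poly_hermitian[OF mf \<open>n \<noteq> m\<close>] moment_functional.zero[OF mf]
    by (auto simp: diag_pmat_def)
  then show "(LINT x:S|lborel. pmat_eval (?D n) x ** direct_sum_weight w x ** conj_transpose (pmat_eval (?D m) x)) = 0"
    by (simp add: vec_eq_iff direct_sum_inner_product_nth[OF w])
qed

text \<open>
  For uniqueness, let \<open>P\<close> be any monic orthogonal sequence.  The \<open>P\<^sub>m\<close> with \<open>m < n\<close> generate all matrix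
  polynomials of lower degree, so \<open>P\<^sub>n\<close> is orthogonal to all of these.  Testing with matrix
  polynomials that have a single nonzero entry \<open>q\<close>, at \<open>(j, j)\<close>, shows that every entry \<open>(i, j)\<close> of
  \<open>P\<^sub>n\<close> is orthogonal to lower degrees with respect to \<open>w\<^sub>j\<close>.
\<close>

lemma monic_ops_direct_sum:
  fixes w :: "'n::finite \<Rightarrow> real \<Rightarrow> real"
  assumes w: "\<And>j. weight_on S (w j)"
  shows "monic_ops S (direct_sum_weight w) n = diag_pmat (\<lambda>j. orth_poly (weight_functional S (w j)) n)"
proof -
  define L where "L j = weight_functional S (w j)" for j
  have mf: "moment_functional (L j)" for j unfolding L_def by (rule weight_moment_functional[OF w])
  have unique: "P = (\<lambda>n. diag_pmat (\<lambda>j. orth_poly (L j) n))"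
    if P: "monic_orthogonal S (direct_sum_weight w) P" for P
  proof
    fix n
    define ip where "ip Q i j = (\<Sum>k\<in>UNIV. L k (P n $ i $ k * map_poly cnj (Q $ j $ k)))"
      for Q :: "'n pmat" and i j
    have "pmat_degree (P n) \<le> n" for n using P by (simp add: monic_orthogonal_def)
    then have deg: "degree (P n $ i $ j) \<le> n" for n i j by (simp add: pmat_degree_le_iff)
    have "pmat_coeff (P n) n $ i $ j = mat 1 $ i $ j" for n i j
      using P by (simp add: monic_orthogonal_def)
    then have lead: "coeff (P n $ i $ j) n = (if i = j then 1 else 0)" for n i j
      by (simp add: pmat_coeff_def mat_def)
    have orth: "ip (P m) i j = 0" if "m < n" for m i j
    proof -
      have "(LINT x:S|lborel. pmat_eval (P n) x ** direct_sum_weight w x ** conj_transpose (pmat_eval (P m) x)) $ i $ j = 0"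
        using P that by (simp add: monic_orthogonal_def)
      then show ?thesis by (simp only: direct_sum_inner_product_nth[OF w] ip_def L_def)
    qed
    have low: "ip Q i j = 0" if "m \<le> n" "\<And>i j k. m \<le> k \<Longrightarrow> coeff (Q $ i $ j) k = 0" for m Q i j
      using that
    proof (induction m arbitrary: Q)
      case 0
      then have "Q $ j $ k = 0" for k by (intro poly_eqI) simp
      then show ?case by (simp add: ip_def moment_functional.zero[OF mf])
    next
      case (Suc m)
      define C where "C a b = coeff (Q $ a $ b) m" for a b
      \<comment> \<open>\<open>Q - C P\<^sub>m\<close>, where \<open>C\<close> is the matrix of coefficients of \<open>x\<^sup>m\<close> in \<open>Q\<close>.\<close>
      define Q' where "Q' = (\<chi> a k. Q $ a $ k - (\<Sum>b\<in>UNIV. smult (C a b) (P m $ b $ k)))"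
      have "coeff (Q' $ a $ c) k = 0" if "m \<le> k" for a c k
      proof (cases "k = m")
        case True
        then show ?thesis by (simp add: Q'_def coeff_sum lead C_def if_distrib[of "(*) _"] cong: if_cong)
      next
        case False
        with that have "m < k" by simp
        then have "coeff (P m $ b $ c) k = 0" for b
          using deg[of m b c] by (simp add: coeff_eq_0)
        then show ?thesis using Suc.prems(2)[of k] \<open>m < k\<close> by (simp add: Q'_def coeff_sum)
      qed
      then have "ip Q' i j = 0" using Suc by simp
      moreover have "Q $ j $ k = Q' $ j $ k + (\<Sum>b\<in>UNIV. smult (C j b) (P m $ b $ k))" for k
        by (simp add: Q'_def)
      then have "ip Q i j = ip Q' i j + (\<Sum>k\<in>UNIV. \<Sum>b\<in>UNIV. cnj (C j b) * L k (P n $ i $ k * map_poly cnj (P m $ b $ k)))"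
        by (simp add: ip_def map_poly_cnj_add map_poly_cnj_sum map_poly_cnj_smult distrib_left
            sum_distrib_left moment_functional.add[OF mf] moment_functional.sum[OF mf]
            moment_functional.smult[OF mf] sum.distrib)
      moreover have "(\<Sum>k\<in>UNIV. \<Sum>b\<in>UNIV. cnj (C j b) * L k (P n $ i $ k * map_poly cnj (P m $ b $ k)))
        = (\<Sum>b\<in>UNIV. cnj (C j b) * ip (P m) i b)"
        unfolding ip_def sum_distrib_left by (rule sum.swap)
      ultimately show ?case using Suc.prems(1) orth by simp
    qed
    have "L j (P n $ i $ j * q) = 0" if q: "degree q < n" for i j q
    proof -
      let ?Q = "(\<chi> a b. if a = j \<and> b = j then map_poly cnj q else 0) :: 'n pmat"
      have "coeff (?Q $ a $ b) k = 0" if "n \<le> k" for a b k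
        using q that by (simp add: coeff_map_poly coeff_eq_0)
      then have "ip ?Q i j = 0" by (intro low[OF order_refl])
      moreover have "map_poly cnj (map_poly cnj q) = q" by (intro poly_eqI) (simp add: coeff_map_poly)
      then have "P n $ i $ k * map_poly cnj (?Q $ j $ k) = (if k = j then P n $ i $ j * q else 0)" for k
        by simp
      then have "L k (P n $ i $ k * map_poly cnj (?Q $ j $ k)) = (if k = j then L j (P n $ i $ j * q) else 0)" for k
        using moment_functional.zero[OF mf] by simp
      then have "ip ?Q i j = L j (P n $ i $ j * q)" by (simp add: ip_def)
      ultimately show ?thesis by simp
    qed
    then have "P n $ i $ j = smult (coeff (P n $ i $ j) n) (orth_poly (L j) n)" for i j
      by (intro moment_functional.orth_multiple[OF mf] deg)
    then show "P n = diag_pmat (\<lambda>j. orth_poly (L j) n)"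
      by (simp add: vec_eq_iff diag_pmat_def) (metis lead smult_0_left smult_1_left)
  qed
  have "monic_orthogonal S (direct_sum_weight w) (\<lambda>n. diag_pmat (\<lambda>j. orth_poly (L j) n))"
    unfolding L_def using w by (rule monic_orthogonal_diag)
  then have "monic_ops S (direct_sum_weight w) = (\<lambda>n. diag_pmat (\<lambda>j. orth_poly (L j) n))"
    unfolding monic_ops_def using unique by (rule the_equality)
  then show ?thesis by (simp add: L_def)
qed

section \<open>Darboux transformations of direct sums\<close>

lemma permuted_scalar_ops_in_diff_ops:
  fixes M :: "'n::finite \<Rightarrow> complex poly \<Rightarrow> complex poly"
  assumes "\<And>j. M j \<in> scalar_diff_ops"
  shows "(\<lambda>P. \<chi> i j. M j (P $ i $ \<sigma> j)) \<in> diff_ops"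
proof -
  have "\<exists>r f. \<forall>R p. r \<le> R \<longrightarrow> M j p = (\<Sum>k\<le>R. (pderiv ^^ k) p * f k)" for j
    using scalar_diff_ops_padE[OF assms[of j]] by metis
  then obtain r f where M: "\<And>j R p. r j \<le> R \<Longrightarrow> M j p = (\<Sum>k\<le>R. (pderiv ^^ k) p * f j k)"
    by metis
  define R where "R = Max (range r)"
  have R: "r j \<le> R" for j unfolding R_def by (rule Max_ge) auto
  define F where "F k = (\<chi> l j. if l = \<sigma> j then f j k else 0)" for k
  have "(\<lambda>P. \<chi> i j. M j (P $ i $ \<sigma> j)) = diff_op R F"
    by (simp add: fun_eq_iff vec_eq_iff diff_op_nth F_def M[OF R] if_distrib[of "(*) _"] cong: if_cong)
  then show ?thesis unfolding diff_ops_def by blast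
qed

lemma permuted_preserves_degree:
  fixes M :: "'n::finite \<Rightarrow> complex poly \<Rightarrow> complex poly"
  assumes "\<And>j. preserves_degree (M j)" and "surj \<sigma>"
  shows "degree_preserving (\<lambda>P. \<chi> i j. M j (P $ i $ \<sigma> j))"
  unfolding degree_preserving_def
proof (intro allI conjI)
  fix P :: "'n pmat"
  let ?Q = "\<chi> i j. M j (P $ i $ \<sigma> j)"
  have all: "(\<forall>i j. A i (\<sigma> j)) \<longleftrightarrow> (\<forall>i l. A i l)" for A :: "'n \<Rightarrow> 'n \<Rightarrow> bool"
    using \<open>surj \<sigma>\<close> by (metis surj_def)
  have "?Q = 0 \<longleftrightarrow> (\<forall>i j. P $ i $ \<sigma> j = 0)"
    using assms(1) by (simp add: vec_eq_iff preserves_degree_def)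
  then show "?Q = 0 \<longleftrightarrow> P = 0" by (simp add: all[of "\<lambda>i l. P $ i $ l = 0"] vec_eq_iff)
  have iff: "pmat_degree ?Q \<le> n \<longleftrightarrow> pmat_degree P \<le> n" for n
    using all[of "\<lambda>i l. degree (P $ i $ l) \<le> n"] assms(1)
    by (simp add: pmat_degree_le_iff preserves_degree_def)
  show "pmat_degree ?Q = pmat_degree P"
    using iff[of "pmat_degree P"] iff[of "pmat_degree ?Q"] by (intro antisym) blast+
qed

text \<open>
  \<open>MV\<close> moves column \<open>\<sigma> j\<close> to column \<open>j\<close> and applies \<open>V j\<close> to it; \<open>MN\<close> moves it back and applies \<open>N j\<close>.
  Their product acts diagonally, so it belongs to the algebra of \<open>W\<close>.
\<close>

lemma intertwined_imp_darboux:
  fixes w w' :: "'n::finite \<Rightarrow> real \<Rightarrow> real"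
  assumes w: "\<And>j. weight_on S (w j)" and w': "\<And>j. weight_on S (w' j)"
    and \<sigma>: "\<sigma> permutes (UNIV :: 'n set)"
    and int: "\<And>j. intertwined (weight_functional S (w (\<sigma> j))) (weight_functional S (w' j))"
  shows "darboux_transformation S (direct_sum_weight w) (direct_sum_weight w')"
proof -
  let ?p = "\<lambda>j. orth_poly (weight_functional S (w j))"
  let ?p' = "\<lambda>j. orth_poly (weight_functional S (w' j))"
  obtain V N where V: "\<And>j. intertwines (weight_functional S (w (\<sigma> j))) (weight_functional S (w' j)) (V j)"
      "\<And>j. preserves_degree (V j)"
    and N: "\<And>j. intertwines (weight_functional S (w' j)) (weight_functional S (w (\<sigma> j))) (N j)"
      "\<And>j. preserves_degree (N j)"
    using int unfolding intertwined_def by metis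
  obtain a where a: "\<And>j n. V j (?p (\<sigma> j) n) = smult (a j n) (?p' j n)"
    using V(1) unfolding intertwines_def by metis
  obtain b where b: "\<And>j n. N j (?p' j n) = smult (b j n) (?p (\<sigma> j) n)"
    using N(1) unfolding intertwines_def by metis
  have V': "V j \<in> scalar_diff_ops" and N': "N j \<in> scalar_diff_ops" for j
    using V N by (auto simp: intertwines_def)
  define \<tau> where "\<tau> = inv \<sigma>"
  have inv: "\<sigma> (\<tau> j) = j" "\<tau> (\<sigma> j) = j" for j
    using permutes_inverses[OF \<sigma>] by (auto simp: \<tau>_def)
  have surj: "surj \<sigma>" "surj \<tau>" using inv by (metis surjI)+
  define MV :: "'n pmat_op" where "MV = (\<lambda>P. \<chi> i j. V j (P $ i $ \<sigma> j))"
  define MN :: "'n pmat_op" where "MN = (\<lambda>P. \<chi> i j. N (\<tau> j) (P $ i $ \<tau> j))"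
  have "MV \<in> diff_ops" unfolding MV_def using V' by (rule permuted_scalar_ops_in_diff_ops)
  moreover have "MN \<in> diff_ops" unfolding MN_def using N' by (rule permuted_scalar_ops_in_diff_ops)
  moreover have "degree_preserving MV" unfolding MV_def using V(2) surj(1) by (rule permuted_preserves_degree)
  moreover have "degree_preserving MN" unfolding MN_def using N(2) surj(2) by (rule permuted_preserves_degree)
  moreover have "\<exists>A. MV (monic_ops S (direct_sum_weight w) n) = const_pmat A ** monic_ops S (direct_sum_weight w') n" for n
  proof
    show "MV (monic_ops S (direct_sum_weight w) n)
      = const_pmat (\<chi> i j. if i = \<sigma> j then a j n else 0) ** monic_ops S (direct_sum_weight w') n"
      unfolding monic_ops_direct_sum[OF w] monic_ops_direct_sum[OF w']
      by (simp add: vec_eq_iff const_pmat_mult_diag_nth)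
        (simp add: MV_def diag_pmat_def a scalar_diff_op_linear(3)[OF V'])
  qed
  moreover have "op_mult MV MN \<in> op_algebra S (direct_sum_weight w)"
    unfolding op_algebra_def
  proof (intro CollectI conjI allI)
    have "op_mult MV MN = (\<lambda>P. \<chi> i j. N (\<tau> j) (V (\<tau> j) (P $ i $ j)))"
      by (simp add: op_mult_def MV_def MN_def inv)
    moreover have "(\<lambda>P. \<chi> i j. N (\<tau> j) (V (\<tau> j) (P $ i $ id j))) \<in> diff_ops"
      using scalar_diff_ops_comp[OF V' N'] by (rule permuted_scalar_ops_in_diff_ops)
    ultimately show "op_mult MV MN \<in> diff_ops" by simp
    fix n
    have "N (\<tau> j) (V (\<tau> j) (?p j n)) = smult (a (\<tau> j) n * b (\<tau> j) n) (?p j n)" for j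
      using a[of "\<tau> j" n] b[of "\<tau> j" n] by (simp add: inv scalar_diff_op_linear[OF N'])
    then have "op_mult MV MN (monic_ops S (direct_sum_weight w) n)
      = const_pmat (\<chi> i j. if i = j then a (\<tau> j) n * b (\<tau> j) n else 0) ** monic_ops S (direct_sum_weight w) n"
      unfolding monic_ops_direct_sum[OF w]
      by (simp add: vec_eq_iff const_pmat_mult_diag_nth)
        (simp add: op_mult_def MV_def MN_def diag_pmat_def inv scalar_diff_op_linear(3)[OF V'] scalar_diff_op_linear(3)[OF N'])
    then show "\<exists>\<Lambda>. op_mult MV MN (monic_ops S (direct_sum_weight w) n)
      = const_pmat \<Lambda> ** monic_ops S (direct_sum_weight w) n" ..
  qed
  ultimately show ?thesis
    unfolding darboux_transformation_def
    by (intro bexI[of _ "op_mult MV MN"] bexI[of _ MV] bexI[of _ MN] conjI allI refl) assumption+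
qed

text \<open>
  On constant matrices \<open>\<V>\<close> is right multiplication by \<open>A\<^sub>0\<close>, as \<open>P\<^sub>0 = P'\<^sub>0 = I\<close>.  It is injective there
  because \<open>\<V>\<close> preserves degrees, so \<open>A\<^sub>0\<close> is invertible, and a nonzero term of the expansion of its
  determinant is the required permutation.
\<close>

lemma darboux_imp_intertwiners:
  fixes w w' :: "'n::finite \<Rightarrow> real \<Rightarrow> real"
  assumes w: "\<And>j. weight_on S (w j)" and w': "\<And>j. weight_on S (w' j)"
    and darboux: "darboux_transformation S (direct_sum_weight w) (direct_sum_weight w')"
  obtains \<sigma> V where "\<sigma> permutes (UNIV :: 'n set)"
    and "\<And>j. intertwines (weight_functional S (w (\<sigma> j))) (weight_functional S (w' j)) (V j)"
    and "\<And>j. V j 1 \<noteq> 0"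
proof -
  let ?p = "\<lambda>j. orth_poly (weight_functional S (w j))"
  let ?p' = "\<lambda>j. orth_poly (weight_functional S (w' j))"
  obtain M where M: "M \<in> diff_ops" "degree_preserving M" and
    MA: "\<forall>n. \<exists>A. M (monic_ops S (direct_sum_weight w) n) = const_pmat A ** monic_ops S (direct_sum_weight w') n"
    using darboux unfolding darboux_transformation_def by (elim bexE conjE) (rule that)
  obtain A where A: "\<And>n. M (monic_ops S (direct_sum_weight w) n) = const_pmat (A n) ** monic_ops S (direct_sum_weight w') n"
    using choice[OF MA] by (elim exE) (rule that, erule spec)
  obtain r F where F: "M = diff_op r F" using M(1) by (auto simp: diff_ops_def)
  define V where "V i j p = (\<Sum>k\<le>r. (pderiv ^^ k) p * F k $ i $ j)" for i j p
  have Mnth: "M P $ i $ j = (\<Sum>l\<in>UNIV. V l j (P $ i $ l))" for P i j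
    unfolding F diff_op_nth V_def by (rule sum.swap)
  have V: "V i j \<in> scalar_diff_ops" for i j
    unfolding scalar_diff_ops_def V_def by auto
  have "M (diag_pmat q) $ i $ j = V i j (q i)" for q i j
  proof -
    have "V l j (diag_pmat q $ i $ l) = (if l = i then V i j (q i) else 0)" for l
      by (auto simp: diag_pmat_def scalar_diff_op_linear(3)[OF V])
    then show ?thesis by (simp add: Mnth)
  qed
  then have Vp: "V i j (?p i n) = smult (A n $ i $ j) (?p' j n)" for i j n
    using A[of n] unfolding monic_ops_direct_sum[OF w] monic_ops_direct_sum[OF w']
    by (metis const_pmat_mult_diag_nth)
  then have V1: "V i j 1 = [:A 0 $ i $ j:]" for i j
    using Vp[of i j 0] moment_functional.orth_poly_0[OF weight_moment_functional[OF w]]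
      moment_functional.orth_poly_0[OF weight_moment_functional[OF w']] by simp
  have "det (A 0) \<noteq> 0"
  proof
    assume "det (A 0) = 0"
    then have "det (transpose (A 0)) = 0" by simp
    then obtain v where v: "transpose (A 0) *v v = 0" "v \<noteq> 0"
      by (metis invertible_det_nz invertible_left_inverse matrix_left_invertible_ker)
    \<comment> \<open>The constant matrix all of whose rows are \<open>v\<close>, so that \<open>C A\<^sub>0 = 0\<close>.\<close>
    define C :: "'n cmat" where "C = (\<chi> i. v)"
    have "M (const_pmat C) = 0"
    proof -
      have "V l j [:c:] = [:c * A 0 $ l $ j:]" for l j c
        using scalar_diff_op_linear(2)[OF V, of l j c 1] by (simp add: V1)
      moreover have "(\<Sum>l\<in>B. [:c l:]) = [:\<Sum>l\<in>B. c l:]" for B and c :: "'n \<Rightarrow> complex"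
        by (induction B rule: infinite_finite_induct) auto
      ultimately have "M (const_pmat C) $ i $ j = [:(transpose (A 0) *v v) $ j:]" for i j
        by (simp add: Mnth const_pmat_def C_def matrix_vector_mult_def transpose_def mult.commute)
      then show ?thesis using v(1) by (simp add: vec_eq_iff)
    qed
    then have "const_pmat C = 0" using M(2) by (simp add: degree_preserving_def)
    then have "v = 0" by (simp add: const_pmat_def C_def vec_eq_iff)
    with v(2) show False ..
  qed
  then obtain \<pi> where \<pi>: "\<pi> permutes (UNIV :: 'n set)" "(\<Prod>i\<in>UNIV. A 0 $ i $ \<pi> i) \<noteq> 0"
    unfolding det_def by (metis (mono_tags, lifting) mult_zero_right sum.neutral mem_Collect_eq)
  define \<sigma> where "\<sigma> = inv \<pi>"
  have \<sigma>: "\<sigma> permutes UNIV" unfolding \<sigma>_def using \<pi>(1) by (rule permutes_inv)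
  show thesis
  proof (rule that[OF \<sigma>, of "\<lambda>j. V (\<sigma> j) j"])
    fix j
    show "intertwines (weight_functional S (w (\<sigma> j))) (weight_functional S (w' j)) (V (\<sigma> j) j)"
      unfolding intertwines_def using V Vp by blast
    have "A 0 $ \<sigma> j $ \<pi> (\<sigma> j) \<noteq> 0" using \<pi>(2) by (simp add: prod_zero_iff)
    moreover have "\<pi> (\<sigma> j) = j" using permutes_inverses(1)[OF \<pi>(1)] by (simp add: \<sigma>_def)
    ultimately show "V (\<sigma> j) j 1 \<noteq> 0" by (simp add: V1)
  qed
qed

section \<open>Intertwiners between classical weights\<close>

lemma laguerre_intertwined_step:
  assumes "\<alpha> > -1"
  shows "intertwined (weight_functional {0<..} (laguerre_weight \<alpha>)) (weight_functional {0<..} (laguerre_weight (\<alpha> + 1)))"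
proof (rule laguerre_step[OF pearson_laguerre[OF assms] assms])
  show "moment_functional (weight_functional {0<..} (laguerre_weight (\<alpha> + 1)))"
    using assms by (intro weight_moment_functional weight_on_laguerre) simp
  show "weight_functional {0<..} (laguerre_weight (\<alpha> + 1)) p
    = weight_functional {0<..} (laguerre_weight \<alpha>) ([:0, 1:] * p)" for p
    by (rule weight_functional_cong) (auto simp: laguerre_weight_def powr_add mult_ac)
qed

lemma laguerre_intertwined_shift:
  assumes "\<alpha> > -1"
  shows "intertwined (weight_functional {0<..} (laguerre_weight \<alpha>))
    (weight_functional {0<..} (laguerre_weight (\<alpha> + of_nat k)))"
proof (induction k)
  case 0
  show ?case by (simp add: intertwined_refl)
next
  case (Suc k)
  have "intertwined (weight_functional {0<..} (laguerre_weight (\<alpha> + of_nat k)))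
    (weight_functional {0<..} (laguerre_weight (\<alpha> + of_nat k + 1)))"
    using assms by (intro laguerre_intertwined_step) simp
  from intertwined_trans[OF Suc.IH this] show ?case by (simp add: add_ac)
qed

lemma laguerre_intertwined:
  assumes "\<alpha> > -1" "\<alpha>' > -1" "\<alpha>' - \<alpha> \<in> \<int>"
  shows "intertwined (weight_functional {0<..} (laguerre_weight \<alpha>)) (weight_functional {0<..} (laguerre_weight \<alpha>'))"
proof -
  obtain k where k: "\<alpha>' - \<alpha> = of_int k" using assms(3) by (auto elim: Ints_cases)
  show ?thesis
  proof (cases "k \<ge> 0")
    case True
    then have "\<alpha>' = \<alpha> + of_nat (nat k)" using k by simp
    then show ?thesis using laguerre_intertwined_shift[OF assms(1)] by simp
  next
    case False
    then have "\<alpha> = \<alpha>' + of_nat (nat (- k))" using k by simp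
    then show ?thesis using intertwined_sym[OF laguerre_intertwined_shift[OF assms(2), of "nat (- k)"]] by simp
  qed
qed

lemma jacobi_intertwined_step:
  assumes "\<alpha> > -1" "\<beta> > -1"
  shows "intertwined (weight_functional {-1<..<1} (jacobi_weight \<alpha> (\<beta> + 1)))
    (weight_functional {-1<..<1} (jacobi_weight (\<alpha> + 1) \<beta>))"
proof (rule jacobi_step[OF pearson_jacobi[OF assms] assms])
  show "moment_functional (weight_functional {-1<..<1} (jacobi_weight \<alpha> (\<beta> + 1)))"
    "moment_functional (weight_functional {-1<..<1} (jacobi_weight (\<alpha> + 1) \<beta>))"
    using assms by (intro weight_moment_functional weight_on_jacobi; simp)+
  show "weight_functional {-1<..<1} (jacobi_weight \<alpha> (\<beta> + 1)) p
    = weight_functional {-1<..<1} (jacobi_weight \<alpha> \<beta>) ([:1, 1:] * p)"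
    "weight_functional {-1<..<1} (jacobi_weight (\<alpha> + 1) \<beta>) p
    = weight_functional {-1<..<1} (jacobi_weight \<alpha> \<beta>) ([:1, -1:] * p)" for p
    by (rule weight_functional_cong; auto simp: jacobi_weight_def powr_add algebra_simps)+
qed

lemma jacobi_intertwined_shift:
  assumes "\<alpha> > -1" "\<beta> > -1"
  shows "intertwined (weight_functional {-1<..<1} (jacobi_weight \<alpha> (\<beta> + of_nat k)))
    (weight_functional {-1<..<1} (jacobi_weight (\<alpha> + of_nat k) \<beta>))"
  using assms
proof (induction k arbitrary: \<beta>)
  case 0
  show ?case by (simp add: intertwined_refl)
next
  case (Suc k)
  have "intertwined (weight_functional {-1<..<1} (jacobi_weight \<alpha> (\<beta> + 1 + of_nat k)))
    (weight_functional {-1<..<1} (jacobi_weight (\<alpha> + of_nat k) (\<beta> + 1)))"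
    using Suc.prems by (intro Suc.IH) auto
  then have "intertwined (weight_functional {-1<..<1} (jacobi_weight \<alpha> (\<beta> + 1 + of_nat k)))
    (weight_functional {-1<..<1} (jacobi_weight (\<alpha> + of_nat k + 1) \<beta>))"
    by (rule intertwined_trans) (use Suc.prems in \<open>auto intro!: jacobi_intertwined_step\<close>)
  then show ?case by (simp add: add_ac)
qed

lemma jacobi_intertwined:
  assumes gt: "\<alpha> > -1" "\<beta> > -1" "\<alpha>' > -1" "\<beta>' > -1"
    and "\<alpha> + \<beta> = \<alpha>' + \<beta>'" "\<alpha>' - \<alpha> \<in> \<int>"
  shows "intertwined (weight_functional {-1<..<1} (jacobi_weight \<alpha> \<beta>)) (weight_functional {-1<..<1} (jacobi_weight \<alpha>' \<beta>'))"
proof -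
  obtain k where k: "\<alpha>' - \<alpha> = of_int k" using assms(6) by (auto elim: Ints_cases)
  show ?thesis
  proof (cases "k \<ge> 0")
    case True
    then have "\<alpha>' = \<alpha> + of_nat (nat k)" "\<beta> = \<beta>' + of_nat (nat k)" using k assms(5) by simp_all
    then show ?thesis using jacobi_intertwined_shift[OF gt(1,4), of "nat k"] by simp
  next
    case False
    then have "\<alpha> = \<alpha>' + of_nat (nat (- k))" "\<beta>' = \<beta> + of_nat (nat (- k))" using k assms(5) by simp_all
    then show ?thesis using intertwined_sym[OF jacobi_intertwined_shift[OF gt(3,2), of "nat (- k)"]] by simp
  qed
qed

lemma classical_weightsE:
  assumes "w \<in> classical_weights t"
  obtains b where "t = Hermite" "w = hermite_weight b"
  | \<alpha> where "t = Laguerre" "w = laguerre_weight \<alpha>" "\<alpha> > -1"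
  | \<alpha> \<beta> where "t = Jacobi" "w = jacobi_weight \<alpha> \<beta>" "\<alpha> > -1" "\<beta> > -1"
  using assms
  by (cases t) (auto simp: hermite_weight_def[abs_def] laguerre_weight_def[abs_def] jacobi_weight_def[abs_def])

lemma weight_on_classical: "w \<in> classical_weights t \<Longrightarrow> weight_on (weight_interval t) w"
  by (erule classical_weightsE) (simp_all add: weight_on_hermite weight_on_laguerre weight_on_jacobi)

text \<open>
  The given \<open>V\<close> may annihilate some orthogonal polynomials, so it cannot serve as a witness itself.
  It restricts the parameters of the weights, and the witnesses are composed of the elementary shifts
  of the parameters.
\<close>

lemma classical_intertwiner_imp_intertwined:
  assumes w: "w \<in> classical_weights t" "w' \<in> classical_weights t"
    and V: "intertwines (weight_functional (weight_interval t) w) (weight_functional (weight_interval t) w') V" "V p \<noteq> 0"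
  shows "intertwined (weight_functional (weight_interval t) w) (weight_functional (weight_interval t) w')"
  using w(1)
proof (cases rule: classical_weightsE)
  case (1 b)
  then obtain b' where b': "w' = hermite_weight b'"
    by (cases rule: classical_weightsE[OF w(2)]) auto
  have "b = b'" using hermite_intertwiner[OF pearson_hermite pearson_hermite] V 1 b' by auto
  then show ?thesis using 1 b' by (simp add: intertwined_refl)
next
  case (2 \<alpha>)
  then obtain \<alpha>' where \<alpha>': "w' = laguerre_weight \<alpha>'" "\<alpha>' > -1"
    by (cases rule: classical_weightsE[OF w(2)]) auto
  have "\<alpha>' - \<alpha> \<in> \<int>"
    using laguerre_intertwiner[OF pearson_laguerre[OF 2(3)] pearson_laguerre[OF \<alpha>'(2)]] V 2 \<alpha>' by auto
  then show ?thesis using laguerre_intertwined 2 \<alpha>' by simp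
next
  case (3 \<alpha> \<beta>)
  then obtain \<alpha>' \<beta>' where j: "w' = jacobi_weight \<alpha>' \<beta>'" "\<alpha>' > -1" "\<beta>' > -1"
    by (cases rule: classical_weightsE[OF w(2)]) auto
  note P = pearson_jacobi[OF 3(3,4)] pearson_jacobi[OF j(2,3)]
  have sum: "\<alpha> + \<beta> = \<alpha>' + \<beta>'"
    using jacobi_intertwiner_same_sum[OF P 3(3) j(2)] V 3 j by auto
  have "\<alpha>' - \<alpha> \<in> \<int>" using jacobi_intertwiner[OF P sum] V 3 j by auto
  then show ?thesis using jacobi_intertwined 3 j sum by simp
qed

theorem theorem6p12:
  fixes t :: weight_type and w w' :: "'n::finite \<Rightarrow> real \<Rightarrow> real"
  assumes "\<And>j. w j \<in> classical_weights t"
    and "\<And>j. w' j \<in> classical_weights t"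
  shows "darboux_transformation (weight_interval t) (direct_sum_weight w) (direct_sum_weight w') \<longleftrightarrow>
    (\<exists>\<sigma>. \<sigma> permutes (UNIV :: 'n set) \<and>
      (\<forall>j. darboux_transformation (weight_interval t)
              (scalar_weight (w (\<sigma> j))) (scalar_weight (w' j))))"
proof -
  let ?S = "weight_interval t"
  let ?L = "\<lambda>i. weight_functional ?S (w i)" and ?L' = "\<lambda>j. weight_functional ?S (w' j)"
  note weight = weight_on_classical[OF assms(1)] weight_on_classical[OF assms(2)]
  have scalar: "darboux_transformation ?S (scalar_weight (w i)) (scalar_weight (w' j)) \<longleftrightarrow>
    intertwined (?L i) (?L' j)" for i j
  proof
    assume "darboux_transformation ?S (scalar_weight (w i)) (scalar_weight (w' j))"
    then obtain V where "intertwines (?L i) (?L' j) V" "V 1 \<noteq> 0"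
      unfolding scalar_weight_def
      by (rule darboux_imp_intertwiners[where w = "\<lambda>_. w i" and w' = "\<lambda>_. w' j", OF weight]) blast
    then show "intertwined (?L i) (?L' j)"
      by (rule classical_intertwiner_imp_intertwined[OF assms])
  next
    assume "intertwined (?L i) (?L' j)"
    then show "darboux_transformation ?S (scalar_weight (w i)) (scalar_weight (w' j))"
      unfolding scalar_weight_def
      by (intro intertwined_imp_darboux[where \<sigma> = id] weight permutes_id) simp
  qed
  show ?thesis unfolding scalar
  proof
    assume "darboux_transformation ?S (direct_sum_weight w) (direct_sum_weight w')"
    then obtain \<sigma> V where \<sigma>: "\<sigma> permutes UNIV"
      and V: "\<And>j. intertwines (?L (\<sigma> j)) (?L' j) (V j)" "\<And>j. V j 1 \<noteq> 0"
      by (rule darboux_imp_intertwiners[OF weight]) blast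
    have "intertwined (?L (\<sigma> j)) (?L' j)" for j
      by (rule classical_intertwiner_imp_intertwined[OF assms V])
    with \<sigma> show "\<exists>\<sigma>. \<sigma> permutes UNIV \<and> (\<forall>j. intertwined (?L (\<sigma> j)) (?L' j))"
      by (intro exI[of _ \<sigma>] conjI allI)
  next
    assume "\<exists>\<sigma>. \<sigma> permutes UNIV \<and> (\<forall>j. intertwined (?L (\<sigma> j)) (?L' j))"
    then obtain \<sigma> where \<sigma>: "\<sigma> permutes UNIV" and \<sigma>j: "\<And>j. intertwined (?L (\<sigma> j)) (?L' j)"
      by blast
    show "darboux_transformation ?S (direct_sum_weight w) (direct_sum_weight w')"
      using weight \<sigma> \<sigma>j by (rule intertwined_imp_darboux)
  qed
qed

end
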